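(* Let $G$ be a forest and $s>0$. Then for any $n\ge1$ agents with arbitrary monotone (continuous, nonnegative) valuations, a maximin allocation exists; that is, there is an $s$-separated allocation $(A_1,\dots,A_n)$ with $v_i(A_i)\ge\mathrm{MMS}_i^{n,s}$ for all $i$.
   Context: Cake model: the cake is a finite undirected graph $G=(V,E)$, possibly disconnected, in which every edge is a segment of positive length; points of $G$ are its vertices and the points on its edges. A piece of cake is a finite union of intervals contained in edges, together possibly with some vertices. A piece $X$ is connected if any two points of $X$ can be joined by a path in $G$ that stays inside $X$. Each agent $i\in[n]$ has a valuation $v_i$ on pieces that is nonnegative, monotone and continuous; in particular, points have value $0$. Distances: $\mathrm{Dist}^G(x,y)$ is the length of a shortest path along the edges, and is $\infty$ if $x$ and $y$ lie in different components. For sets, $\mathrm{Dist}^G(X,Y)=\inf_{x\in X,y\in Y}\mathrm{Dist}^G(x,y)$. Separation: a $k$-partition is $s$-separated if it consists of $k$ pairwise disjoint connected pieces $P_1,\dots,P_k$ (not necessarily covering $G$) with $\mathrm{Dist}^G(P_i,P_j)\ge s$ for all $i\ne j$. An $s$-separated allocation is a vector $(A_1,\dots,A_n)$ of connected pieces satisfying the same condition. Maximin share: $\mathrm{MMS}_i^{k,s}=\sup\min_{j\in[k]}v_i(P_j)$, where the supremum ranges over $s$-separated $k$-partitions. *)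

theory Defs
  imports "HOL-Analysis.Analysis"
begin

text \<open>A finite undirected (multi)graph whose edges are segments of positive length.
  Edges are indexed by an arbitrary type; each edge has two endpoints and a length.\<close>

record ('v, 'e) cgraph =
  verts :: "'v set"
  edges :: "'e set"
  ends  :: "'e \<Rightarrow> 'v \<times> 'v"
  elen  :: "'e \<Rightarrow> real"

definition wf_cgraph :: "('v, 'e) cgraph \<Rightarrow> bool" where
  "wf_cgraph G \<longleftrightarrow> finite (verts G) \<and> finite (edges G) \<and>
     (\<forall>e\<in>edges G. fst (ends G e) \<in> verts G \<and> snd (ends G e) \<in> verts G \<and> elen G e > 0)"

text \<open>A cycle: a nonempty list of distinct edges traversing a closed vertex sequence whose
  vertices (apart from the repeated endpoint) are distinct. Covers loops and parallel edges.\<close>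
definition has_cycle :: "('v, 'e) cgraph \<Rightarrow> bool" where
  "has_cycle G \<longleftrightarrow> (\<exists>es vs. es \<noteq> [] \<and> distinct es \<and> set es \<subseteq> edges G \<and>
     length vs = length es + 1 \<and> hd vs = last vs \<and> distinct (butlast vs) \<and>
     (\<forall>i<length es. ends G (es ! i) = (vs ! i, vs ! Suc i) \<or> ends G (es ! i) = (vs ! Suc i, vs ! i)))"

definition forest :: "('v, 'e) cgraph \<Rightarrow> bool" where
  "forest G \<longleftrightarrow> \<not> has_cycle G"

datatype ('v, 'e) gpoint = Vtx 'v | Inn 'e real

definition points :: "('v, 'e) cgraph \<Rightarrow> ('v, 'e) gpoint set" where
  "points G = Vtx ` verts G \<union> {Inn e t | e t. e \<in> edges G \<and> 0 < t \<and> t < elen G e}"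

definition pt :: "('v, 'e) cgraph \<Rightarrow> 'e \<Rightarrow> real \<Rightarrow> ('v, 'e) gpoint" where
  "pt G e t = (if t = 0 then Vtx (fst (ends G e))
               else if t = elen G e then Vtx (snd (ends G e)) else Inn e t)"

definition piece :: "('v, 'e) cgraph \<Rightarrow> ('v, 'e) gpoint set \<Rightarrow> bool" where
  "piece G X \<longleftrightarrow> (\<exists>F W. finite F \<and> W \<subseteq> verts G \<and>
     (\<forall>(e, I)\<in>F. e \<in> edges G \<and> is_interval I \<and> I \<subseteq> {0 .. elen G e}) \<and>
     X = (\<Union>(e, I)\<in>F. pt G e ` I) \<union> Vtx ` W)"

text \<open>A path is a list of steps (e, a, b): move along edge e from parameter a to parameter b.\<close>
definition is_path :: "('v, 'e) cgraph \<Rightarrow> ('v, 'e) gpoint \<Rightarrow> ('v, 'e) gpoint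
    \<Rightarrow> ('e \<times> real \<times> real) list \<Rightarrow> bool" where
  "is_path G x y ss \<longleftrightarrow>
     (ss = [] \<and> x = y \<and> x \<in> points G) \<or>
     (ss \<noteq> [] \<and>
      (\<forall>(e, a, b)\<in>set ss. e \<in> edges G \<and> a \<in> {0 .. elen G e} \<and> b \<in> {0 .. elen G e}) \<and>
      (case hd ss of (e, a, b) \<Rightarrow> pt G e a = x) \<and>
      (case last ss of (e, a, b) \<Rightarrow> pt G e b = y) \<and>
      (\<forall>i. Suc i < length ss \<longrightarrow>
          (case ss ! i of (e, a, b) \<Rightarrow> pt G e b) = (case ss ! Suc i of (e, a, b) \<Rightarrow> pt G e a)))"

definition path_len :: "('e \<times> real \<times> real) list \<Rightarrow> real" where
  "path_len ss = sum_list (map (\<lambda>(e, a, b). \<bar>b - a\<bar>) ss)"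

definition path_trace :: "('v, 'e) cgraph \<Rightarrow> ('v, 'e) gpoint \<Rightarrow> ('e \<times> real \<times> real) list
    \<Rightarrow> ('v, 'e) gpoint set" where
  "path_trace G x ss = {x} \<union> (\<Union>(e, a, b)\<in>set ss. pt G e ` closed_segment a b)"

definition connected_piece :: "('v, 'e) cgraph \<Rightarrow> ('v, 'e) gpoint set \<Rightarrow> bool" where
  "connected_piece G X \<longleftrightarrow>
     (\<forall>x\<in>X. \<forall>y\<in>X. \<exists>ss. is_path G x y ss \<and> path_trace G x ss \<subseteq> X)"

text \<open>Shortest-path distance (infinite if no path exists).\<close>
definition Dist :: "('v, 'e) cgraph \<Rightarrow> ('v, 'e) gpoint \<Rightarrow> ('v, 'e) gpoint \<Rightarrow> ereal" where
  "Dist G x y = Inf {ereal (path_len ss) | ss. is_path G x y ss}"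

definition DistSet :: "('v, 'e) cgraph \<Rightarrow> ('v, 'e) gpoint set \<Rightarrow> ('v, 'e) gpoint set \<Rightarrow> ereal" where
  "DistSet G X Y = Inf {Dist G x y | x y. x \<in> X \<and> y \<in> Y}"

definition separated :: "('v, 'e) cgraph \<Rightarrow> nat \<Rightarrow> real \<Rightarrow> (nat \<Rightarrow> ('v, 'e) gpoint set) \<Rightarrow> bool" where
  "separated G k s P \<longleftrightarrow>
     (\<forall>i<k. piece G (P i) \<and> connected_piece G (P i)) \<and>
     (\<forall>i<k. \<forall>j<k. i \<noteq> j \<longrightarrow> P i \<inter> P j = {} \<and> DistSet G (P i) (P j) \<ge> ereal s)"

definition plen :: "('v, 'e) cgraph \<Rightarrow> ('v, 'e) gpoint set \<Rightarrow> real" where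
  "plen G X = (\<Sum>e\<in>edges G. measure lebesgue {t. 0 < t \<and> t < elen G e \<and> Inn e t \<in> X})"

definition valuation :: "('v, 'e) cgraph \<Rightarrow> (('v, 'e) gpoint set \<Rightarrow> real) \<Rightarrow> bool" where
  "valuation G v \<longleftrightarrow>
     (\<forall>X. piece G X \<longrightarrow> v X \<ge> 0) \<and>
     (\<forall>X Y. piece G X \<longrightarrow> piece G Y \<longrightarrow> X \<subseteq> Y \<longrightarrow> v X \<le> v Y) \<and>
     (\<forall>x\<in>points G. v {x} = 0) \<and>
     (\<forall>X. piece G X \<longrightarrow> (\<forall>\<epsilon>>0. \<exists>\<delta>>0. \<forall>Y. piece G Y \<longrightarrow>
         plen G (X - Y) + plen G (Y - X) < \<delta> \<longrightarrow> \<bar>v Y - v X\<bar> < \<epsilon>))"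

definition MMS :: "('v, 'e) cgraph \<Rightarrow> (('v, 'e) gpoint set \<Rightarrow> real) \<Rightarrow> nat \<Rightarrow> real \<Rightarrow> real" where
  "MMS G v k s = Sup {Min ((\<lambda>j. v (P j)) ` {..<k}) | P. separated G k s P}"

end

theory Submission
  imports Defs
begin

text \<open>Root every component of the forest, so that points have a depth. Among all pieces of the
  optimal partitions of all agents, give one whose topmost point is deepest to its owner. Two
  \<open>s\<close>-separated connected pieces whose topmost points are no deeper cannot both be closer than \<open>s\<close>
  to it, so every other agent loses at most one piece, and the argument repeats. Optimal partitions exist
  by compactness: a connected piece meets each edge in an interval, so a maximising sequence of
  partitions has a subsequence along which the endpoints of these intervals converge and the
  combinatorial type is constant.\<close>

section \<open>Walks\<close>

text \<open>The forest enters through a depth function on vertices: along an edge it changes by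
  exactly the length, and no vertex is the deeper end of two edges. Hence the way up from a point is
  forced, and a walk starting below a point \<open>t\<close> can leave the part below
  \<open>t\<close> only through \<open>t\<close>; the geometric arguments rest on this. The obstacle
  is that a piece may omit its end points: it may lack a topmost point, and partitions at hand need
  not attain the supremum. Closed limit pieces cure both defects at once. Since intervals on
  different edges are joined only at vertices, the vertices present are recorded besides the
  interval ends; otherwise connectedness could not be followed to the limit. Every agent starts with
  as many pieces as there are agents, which is just enough when each round removes one agent and at
  most one piece of every other agent. Empty pieces are connected and conflict with nothing.\<close>

inductive walk :: "('v, 'e) cgraph \<Rightarrow> ('v, 'e) gpoint set \<Rightarrow> ('v, 'e) gpoint
    \<Rightarrow> ('v, 'e) gpoint \<Rightarrow> real \<Rightarrow> bool" for G X x where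
  walk_refl: "x \<in> X \<Longrightarrow> x \<in> points G \<Longrightarrow> walk G X x x 0"
| walk_step: "walk G X x (pt G e a) l \<Longrightarrow> e \<in> edges G \<Longrightarrow> a \<in> {0..elen G e} \<Longrightarrow> b \<in> {0..elen G e}
    \<Longrightarrow> pt G e ` closed_segment a b \<subseteq> X \<Longrightarrow> walk G X x (pt G e b) (l + \<bar>b - a\<bar>)"

lemma pt_in_points:
  "wf_cgraph G \<Longrightarrow> e \<in> edges G \<Longrightarrow> t \<in> {0..elen G e} \<Longrightarrow> pt G e t \<in> points G"
  by (auto simp: wf_cgraph_def points_def pt_def)

lemma walk_mem:
  assumes "walk G X x y l" shows "x \<in> X" "y \<in> X" "x \<in> points G" "0 \<le> l"
  using assms by (induction rule: walk.induct) auto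

lemma walk_trans:
  assumes "walk G X y z l'" "walk G X x y l" shows "walk G X x z (l + l')"
  using assms
proof (induction rule: walk.induct)
  case (walk_step e a l' b)
  then have "walk G X x (pt G e b) (l + l' + \<bar>b - a\<bar>)"
    by (intro walk.walk_step) auto
  then show ?case by (simp add: add.assoc)
qed simp

lemma walk_edge:
  assumes "wf_cgraph G" "e \<in> edges G" "a \<in> {0..elen G e}" "b \<in> {0..elen G e}"
    "pt G e ` closed_segment a b \<subseteq> X"
  shows "walk G X (pt G e a) (pt G e b) \<bar>b - a\<bar>"
proof -
  have "walk G X (pt G e a) (pt G e a) 0"
    using assms by (intro walk_refl pt_in_points) auto
  from walk_step[OF this assms(2-5)] show ?thesis by simp
qed

lemma walk_sym:
  assumes "wf_cgraph G" "walk G X x y l" shows "walk G X y x l"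
  using assms(2)
proof (induction rule: walk.induct)
  case (walk_step e a l b)
  have "walk G X (pt G e b) (pt G e a) \<bar>a - b\<bar>"
    using walk_step by (intro walk_edge assms) (auto simp: closed_segment_commute)
  from walk_trans[OF walk_step.IH this] show ?case
    by (simp add: abs_minus_commute add.commute)
qed (rule walk.walk_refl)

text \<open>\<open>walk\<close> grows at its end, so a list of steps has to be taken apart there;
  the only new junction is the one between the last step of \<open>ss\<close> and the added
  step.\<close>

lemma is_path_snoc:
  assumes "wf_cgraph G"
  shows "is_path G x y (ss @ [(e, a, b)]) \<longleftrightarrow> e \<in> edges G \<and> a \<in> {0..elen G e} \<and> b \<in> {0..elen G e}
    \<and> y = pt G e b \<and> is_path G x (pt G e a) ss"
proof (cases "ss = []")
  case True
  then show ?thesis using pt_in_points[OF assms] by (auto simp: is_path_def)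
next
  case False
  let ?P = "\<lambda>i ss. (case ss ! i of (e, a, b) \<Rightarrow> pt G e b) = (case ss ! Suc i of (e, a, b) \<Rightarrow> pt G e a)"
  let ?s = "ss @ [(e, a, b)]"
  have iff: "(\<forall>i. Suc i < length ?s \<longrightarrow> ?P i ?s) \<longleftrightarrow>
      (\<forall>i. Suc i < length ss \<longrightarrow> ?P i ss) \<and> (case last ss of (e, a, b) \<Rightarrow> pt G e b) = pt G e a"
    (is "?L \<longleftrightarrow> ?R")
  proof
    assume L: ?L
    have "?P i ss" if "Suc i < length ss" for i
      using L[rule_format, of i] that by (simp add: nth_append)
    moreover have "?P (length ss - 1) ?s" using L False by simp
    ultimately show ?R using False by (simp add: nth_append last_conv_nth)
  next
    assume R: ?R
    show ?L
    proof (intro allI impI)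
      fix i assume i: "Suc i < length ?s"
      show "?P i ?s"
      proof (cases "Suc i < length ss")
        case True then show ?thesis using R by (simp add: nth_append)
      next
        case neq: False
        with i have "i = length ss - 1" "Suc i = length ss" using False by auto
        then show ?thesis using R False by (auto simp: nth_append last_conv_nth)
      qed
    qed
  qed
  show ?thesis unfolding is_path_def iff using False by auto
qed

lemma path_trace_snoc:
  "path_trace G x (ss @ [(e, a, b)]) = path_trace G x ss \<union> pt G e ` closed_segment a b"
  by (auto simp: path_trace_def)

text \<open>Replaces lists of steps by rule induction that controls trace and length together. With
  a piece for \<open>X\<close> this expresses connectedness, with \<open>UNIV\<close>
  distance.\<close>

lemma walk_iff:
  assumes "wf_cgraph G"
  shows "walk G X x y l \<longleftrightarrow> (\<exists>ss. is_path G x y ss \<and> path_trace G x ss \<subseteq> X \<and> path_len ss = l)"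
proof
  assume "walk G X x y l"
  then show "\<exists>ss. is_path G x y ss \<and> path_trace G x ss \<subseteq> X \<and> path_len ss = l"
  proof (induction rule: walk.induct)
    case walk_refl
    then show ?case by (intro exI[of _ "[]"]) (auto simp: is_path_def path_trace_def path_len_def)
  next
    case (walk_step e a l b)
    then obtain ss where "is_path G x (pt G e a) ss" "path_trace G x ss \<subseteq> X" "path_len ss = l"
      by auto
    with walk_step show ?case
      by (intro exI[of _ "ss @ [(e, a, b)]"])
        (auto simp: is_path_snoc[OF assms] path_trace_snoc path_len_def)
  qed
next
  have "walk G X x y (path_len ss)" if "is_path G x y ss" "path_trace G x ss \<subseteq> X" for ss
    using that
  proof (induction ss arbitrary: y rule: rev_induct)
    case Nil
    then show ?case by (auto simp: is_path_def path_trace_def path_len_def intro: walk_refl)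
  next
    case (snoc st ss)
    obtain e a b where st: "st = (e, a, b)" by (cases st)
    from snoc.prems have *: "e \<in> edges G" "a \<in> {0..elen G e}" "b \<in> {0..elen G e}" "y = pt G e b"
        "is_path G x (pt G e a) ss" "path_trace G x ss \<subseteq> X" "pt G e ` closed_segment a b \<subseteq> X"
      unfolding st is_path_snoc[OF assms] path_trace_snoc by auto
    from walk_step[OF snoc.IH[OF *(5,6)] *(1-3,7)] show ?case
      by (simp add: *(4) st path_len_def)
  qed
  then show "\<exists>ss. is_path G x y ss \<and> path_trace G x ss \<subseteq> X \<and> path_len ss = l \<Longrightarrow> walk G X x y l"
    by auto
qed

lemma connected_piece_walk:
  "wf_cgraph G \<Longrightarrow> connected_piece G X \<longleftrightarrow> (\<forall>x\<in>X. \<forall>y\<in>X. \<exists>l. walk G X x y l)"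
  by (auto simp: connected_piece_def walk_iff)

text \<open>A distance bound free of infima and of \<open>ereal\<close>. Points in different
  components and empty sets satisfy it vacuously, in agreement with an infinite infimum.\<close>

definition far :: "('v, 'e) cgraph \<Rightarrow> real \<Rightarrow> ('v, 'e) gpoint set \<Rightarrow> ('v, 'e) gpoint set \<Rightarrow> bool" where
  "far G s X Y \<longleftrightarrow> (\<forall>x\<in>X. \<forall>y\<in>Y. \<forall>l. walk G UNIV x y l \<longrightarrow> s \<le> l)"

lemma far_sym: "wf_cgraph G \<Longrightarrow> far G s X Y \<Longrightarrow> far G s Y X"
  by (auto simp: far_def dest: walk_sym)

lemma far_DistSet:
  assumes "wf_cgraph G" shows "far G s X Y \<longleftrightarrow> DistSet G X Y \<ge> ereal s"
proof
  assume far: "far G s X Y"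
  have "ereal s \<le> Dist G x y" if "x \<in> X" "y \<in> Y" for x y
    unfolding Dist_def
  proof (rule Inf_greatest)
    fix d assume "d \<in> {ereal (path_len ss) |ss. is_path G x y ss}"
    then obtain ss where "d = ereal (path_len ss)" "is_path G x y ss" by blast
    moreover from this have "walk G UNIV x y (path_len ss)" using walk_iff[OF assms] by blast
    ultimately show "ereal s \<le> d" using far that by (auto simp: far_def)
  qed
  then show "DistSet G X Y \<ge> ereal s" unfolding DistSet_def by (intro Inf_greatest) auto
next
  assume dist: "DistSet G X Y \<ge> ereal s"
  show "far G s X Y" unfolding far_def
  proof (intro ballI allI impI)
    fix x y l assume xy: "x \<in> X" "y \<in> Y" and "walk G UNIV x y l"
    then obtain ss where "is_path G x y ss" "path_len ss = l" using walk_iff[OF assms] by blast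
    then have "Dist G x y \<le> ereal l" unfolding Dist_def by (intro Inf_lower) auto
    moreover have "DistSet G X Y \<le> Dist G x y"
      unfolding DistSet_def using xy by (intro Inf_lower) auto
    ultimately have "ereal s \<le> ereal l" using dist by order
    then show "s \<le> l" by simp
  qed
qed

lemma piece_points:
  assumes "wf_cgraph G" "piece G X" shows "X \<subseteq> points G"
proof
  fix x assume "x \<in> X"
  from assms(2) obtain F W where *: "W \<subseteq> verts G" "X = (\<Union>(e, I)\<in>F. pt G e ` I) \<union> Vtx ` W"
      "\<forall>(e, I)\<in>F. e \<in> edges G \<and> is_interval I \<and> I \<subseteq> {0 .. elen G e}"
    unfolding piece_def by blast
  from \<open>x \<in> X\<close> *(2) consider w where "w \<in> W" "x = Vtx w"
    | e I t where "(e, I) \<in> F" "t \<in> I" "x = pt G e t" by auto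
  then show "x \<in> points G"
  proof cases
    case 1
    then show ?thesis using *(1) by (auto simp: points_def)
  next
    case 2
    then have "e \<in> edges G" "t \<in> {0..elen G e}" using *(3) by fast+
    then show ?thesis using pt_in_points[OF assms(1)] 2(3) by simp
  qed
qed

lemma separated_far:
  assumes "wf_cgraph G" "s > 0"
  shows "separated G k s P \<longleftrightarrow> (\<forall>i<k. piece G (P i) \<and> connected_piece G (P i)) \<and>
    (\<forall>i<k. \<forall>j<k. i \<noteq> j \<longrightarrow> far G s (P i) (P j))"
proof -
  \<comment> \<open>The constant walk at a common point has length 0, which is below
    \<open>s\<close>.\<close>
  have "X \<inter> Y = {}" if "far G s X Y" "piece G X" for X Y
  proof (rule ccontr)
    assume "X \<inter> Y \<noteq> {}"
    then obtain x where x: "x \<in> X" "x \<in> Y" by blast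
    then have "walk G UNIV x x 0" using piece_points[OF assms(1) that(2)] by (auto intro: walk_refl)
    then show False using that(1) x assms(2) by (force simp: far_def)
  qed
  then show ?thesis unfolding separated_def far_DistSet[OF assms(1), symmetric] by (meson order.strict_trans1)
qed

section \<open>Heights on a forest\<close>

definition lower :: "('v, 'e) cgraph \<Rightarrow> ('v \<Rightarrow> real) \<Rightarrow> 'e \<Rightarrow> 'v" where
  "lower G h e = (if h (fst (ends G e)) < h (snd (ends G e)) then snd (ends G e) else fst (ends G e))"

text \<open>A rooting without named roots. Values grow away from the root, so \<open>lower\<close>
  picks the end with the larger value, the child; injectivity says that a vertex has at most one
  edge to a parent.\<close>

definition height_function :: "('v, 'e) cgraph \<Rightarrow> ('v \<Rightarrow> real) \<Rightarrow> bool" where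
  "height_function G h \<longleftrightarrow>
     (\<forall>e\<in>edges G. \<bar>h (fst (ends G e)) - h (snd (ends G e))\<bar> = elen G e) \<and> inj_on (lower G h) (edges G)"

section \<open>Leaves of a forest and existence of a height function\<close>

definition joins :: "('v, 'e) cgraph \<Rightarrow> 'e \<Rightarrow> 'v \<Rightarrow> 'v \<Rightarrow> bool" where
  "joins G e u w \<longleftrightarrow> ends G e = (u, w) \<or> ends G e = (w, u)"

definition trail :: "('v, 'e) cgraph \<Rightarrow> 'e list \<Rightarrow> 'v list \<Rightarrow> bool" where
  "trail G es vs \<longleftrightarrow> distinct es \<and> set es \<subseteq> edges G \<and> length vs = length es + 1 \<and>
     (\<forall>i<length es. joins G (es ! i) (vs ! i) (vs ! Suc i))"

lemma has_cycle_trail: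
  "has_cycle G \<longleftrightarrow> (\<exists>es vs. es \<noteq> [] \<and> trail G es vs \<and> hd vs = last vs \<and> distinct (butlast vs))"
  unfolding has_cycle_def trail_def joins_def by (intro ex_cong1) auto

lemma trail_Cons:
  assumes "trail G es vs" "e \<in> edges G" "e \<notin> set es" "joins G e w (hd vs)"
  shows "trail G (e # es) (w # vs)"
proof -
  have "vs \<noteq> []" using assms(1) by (auto simp: trail_def)
  then show ?thesis using assms by (auto simp: trail_def nth_Cons hd_conv_nth split: nat.split)
qed

lemma trail_take:
  assumes "trail G es vs" shows "trail G (take k es) (take (Suc k) vs)"
  using assms by (auto simp: trail_def dest: in_set_takeD)

text \<open>The first vertex of a longest trail with distinct vertices is a leaf: a second edge
  there would either lengthen the trail or close a cycle with it.\<close>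

lemma forest_leaf:
  assumes wf: "wf_cgraph G" and "forest G" and "edges G \<noteq> {}"
  obtains e u w where "e \<in> edges G" "joins G e u w" "u \<noteq> w"
    "\<And>f x. f \<in> edges G \<Longrightarrow> f \<noteq> e \<Longrightarrow> \<not> joins G f u x"
proof -
  define Q where "Q = (\<lambda>vs. \<exists>es. es \<noteq> [] \<and> trail G es vs \<and> distinct vs)"
  have noloop: "u \<noteq> w" if "e \<in> edges G" "joins G e u w" for e u w
  proof
    assume "u = w"
    then have "trail G [e] [u, u]" using that by (auto simp: trail_def)
    then have "has_cycle G"
      unfolding has_cycle_trail by (intro exI[of _ "[e]"] exI[of _ "[u, u]"]) auto
    with \<open>forest G\<close> show False by (simp add: forest_def)
  qed
  have joins_verts: "u \<in> verts G" "w \<in> verts G" if "e \<in> edges G" "joins G e u w" for e u w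
    using wf that by (auto simp: wf_cgraph_def joins_def)
  obtain e where e: "e \<in> edges G" using assms(3) by blast
  obtain u w where uw: "ends G e = (u, w)" by (cases "ends G e")
  have "Q [u, w]"
    unfolding Q_def using e uw noloop[OF e, of u w]
    by (intro exI[of _ "[e]"]) (auto simp: trail_def joins_def)
  moreover have "length vs \<le> card (verts G)" if vs: "Q vs" for vs
  proof -
    obtain es where es: "es \<noteq> []" "trail G es vs" "distinct vs" using vs by (auto simp: Q_def)
    have "vs ! i \<in> verts G" if "i < length vs" for i
    proof (cases "i < length es")
      case True
      then have "es ! i \<in> edges G" "joins G (es ! i) (vs ! i) (vs ! Suc i)"
        using es(2) by (auto simp: trail_def)
      then show ?thesis using joins_verts by blast
    next
      case False
      define k where "k = length es - 1"
      have "k < length es" "i = Suc k" using False that es by (auto simp: trail_def k_def)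
      then have "es ! k \<in> edges G" "joins G (es ! k) (vs ! k) (vs ! i)"
        using es(2) by (auto simp: trail_def)
      then show ?thesis using joins_verts by blast
    qed
    then have "set vs \<subseteq> verts G" by (auto simp: in_set_conv_nth)
    then show ?thesis using es(3) wf
      by (metis card_mono distinct_card wf_cgraph_def)
  qed
  ultimately obtain vs where "Q vs" and maximal: "\<And>vs'. Q vs' \<Longrightarrow> length vs' \<le> length vs"
    using ex_has_greatest_nat[of Q "[u, w]" length "Suc (card (verts G))"] by (auto simp: less_Suc_eq_le)
  then obtain es where es: "es \<noteq> []" "trail G es vs" "distinct vs" by (auto simp: Q_def)
  define u where "u = hd vs"
  have len: "length vs = length es + 1" "0 < length es" using es by (auto simp: trail_def)
  then have u: "u = vs ! 0" by (cases vs) (auto simp: u_def)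
  have e0: "es ! 0 \<in> edges G" "joins G (es ! 0) u (vs ! 1)" using es len by (auto simp: trail_def u)
  show ?thesis
  proof (rule that[OF e0 noloop[OF e0]], rule notI)
    fix f w assume f: "f \<in> edges G" "f \<noteq> es ! 0" and uw: "joins G f u w"
    then have wu: "joins G f w u" by (auto simp: joins_def)
    have "f \<notin> set es"
    proof
      assume "f \<in> set es"
      then obtain i where i: "i < length es" "f = es ! i" by (auto simp: in_set_conv_nth)
      then have "joins G f (vs ! i) (vs ! Suc i)" using es by (auto simp: trail_def)
      \<comment> \<open>The vertices are distinct, so the only edge of the trail at
        \<open>vs ! 0\<close> is its first one.\<close>
      then have "vs ! i = vs ! 0 \<or> vs ! Suc i = vs ! 0" using uw by (auto simp: joins_def u)
      then have "i = 0" using i len es(3) by (auto simp: nth_eq_iff_index_eq)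
      then show False using f i by auto
    qed
    note ext = trail_Cons[OF _ f(1)]
    show False
    proof (cases "w \<in> set vs")
      case False
      have "trail G (f # es) (w # vs)" using \<open>f \<notin> set es\<close> es wu by (intro ext) (auto simp: u_def)
      then have "Q (w # vs)" using es False by (auto simp: Q_def)
      from maximal[OF this] show False by simp
    next
      case True
      then obtain k where k: "k < length vs" "w = vs ! k" by (auto simp: in_set_conv_nth)
      \<comment> \<open>Cut the trail where it reaches \<open>w\<close>; together with
        \<open>f\<close> the initial part is a closed trail. For \<open>k = 0\<close> it is a
        loop.\<close>
      have "trail G (f # take k es) (w # take (Suc k) vs)"
        using \<open>f \<notin> set es\<close> es wu len by (intro ext trail_take) (auto simp: u_def dest: in_set_takeD)
      moreover have "last (take (Suc k) vs) = w" "butlast (take (Suc k) vs) = take k vs"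
        using k by (auto simp: take_Suc_conv_app_nth)
      moreover have "vs ! k \<notin> set (take k vs)"
        using k es(3) by (auto simp: in_set_conv_nth nth_eq_iff_index_eq)
      ultimately have "has_cycle G"
        unfolding has_cycle_trail using k es(3) len
        by (intro exI[of _ "f # take k es"] exI[of _ "w # take (Suc k) vs"]) auto
      with \<open>forest G\<close> show False by (simp add: forest_def)
    qed
  qed
qed

text \<open>Induction on the number of edges: delete the edge \<open>e\<close> at a leaf
  \<open>u\<close>, then hang \<open>u\<close> below its neighbour at distance
  \<open>elen G e\<close>. No other edge meets \<open>u\<close>, so resetting its value disturbs
  nothing, and \<open>u\<close> becomes the lower end of \<open>e\<close> alone.\<close>

lemma forest_height_function:
  assumes "wf_cgraph G" "forest G" obtains h where "height_function G h"
proof -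
  have "\<exists>h. height_function G h" using assms
  proof (induction "card (edges G)" arbitrary: G)
    case 0
    then have "edges G = {}" by (auto simp: wf_cgraph_def)
    then show ?case by (auto simp: height_function_def)
  next
    case (Suc n)
    then have "edges G \<noteq> {}" by auto
    from forest_leaf[OF Suc.prems this] obtain e u w
      where e: "e \<in> edges G" "joins G e u w" "u \<noteq> w"
        and leaf: "\<And>f x. f \<in> edges G \<Longrightarrow> f \<noteq> e \<Longrightarrow> \<not> joins G f u x" by metis
    define H where "H = G\<lparr>edges := edges G - {e}\<rparr>"
    have "n = card (edges H)" using Suc(2) e(1) by (simp add: H_def)
    moreover have "wf_cgraph H" using Suc.prems by (auto simp: wf_cgraph_def H_def)
    moreover have "forest H" using Suc.prems(2)
      by (fastforce simp: forest_def has_cycle_def H_def)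
    ultimately obtain h where h: "height_function H h" using Suc(1) by blast
    define h' where "h' = h(u := h w + elen G e)"
    have pos: "elen G e > 0" using Suc.prems e by (auto simp: wf_cgraph_def)
    have other: "fst (ends G f) \<noteq> u" "snd (ends G f) \<noteq> u" if "f \<in> edges G" "f \<noteq> e" for f
      using leaf[OF that, of "snd (ends G f)"] leaf[OF that, of "fst (ends G f)"]
      by (auto simp: joins_def)
    have low: "lower G h' f = lower H h f" "lower G h' f \<noteq> u" if "f \<in> edges G" "f \<noteq> e" for f
      using other[OF that] by (auto simp: lower_def h'_def H_def)
    have lowe: "lower G h' e = u"
      using e(2)[unfolded joins_def] e(3) pos by (elim disjE) (simp_all add: lower_def h'_def)
    have "inj_on (lower G h') (edges G)"
    proof (rule inj_onI)
      fix f g assume "f \<in> edges G" "g \<in> edges G" "lower G h' f = lower G h' g"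
      then show "f = g"
        using low[of f] low[of g] lowe h
        by (cases "f = e"; cases "g = e") (auto simp: height_function_def H_def dest: inj_onD)
    qed
    moreover have "\<bar>h' (fst (ends G f)) - h' (snd (ends G f))\<bar> = elen G f" if "f \<in> edges G" for f
    proof (cases "f = e")
      case True
      then show ?thesis
        using e(2)[unfolded joins_def] e(3) pos by (elim disjE) (simp_all add: h'_def)
    next
      case False
      then show ?thesis using other[OF that False] h that
        by (auto simp: h'_def height_function_def H_def)
    qed
    ultimately show ?case by (intro exI[of _ h']) (simp add: height_function_def)
  qed
  then show ?thesis using that by blast
qed

section \<open>Descent in a rooted forest\<close>

locale height_forest =
  fixes G :: "('v, 'e) cgraph" and h :: "'v \<Rightarrow> real"
  assumes wf: "wf_cgraph G" and height: "height_function G h"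
begin

abbreviation on :: "'e \<Rightarrow> real \<Rightarrow> bool" where
  "on e t \<equiv> e \<in> edges G \<and> t \<in> {0..elen G e}"

definition slope :: "'e \<Rightarrow> real" where
  "slope e = (if h (fst (ends G e)) < h (snd (ends G e)) then 1 else - 1)"

definition depth :: "('v, 'e) gpoint \<Rightarrow> real" where
  "depth p = (case p of Vtx v \<Rightarrow> h v | Inn e t \<Rightarrow> h (fst (ends G e)) + slope e * t)"

lemma elen_pos: "e \<in> edges G \<Longrightarrow> elen G e > 0"
  using wf by (auto simp: wf_cgraph_def)

lemma slope_cases: "slope e = 1 \<or> slope e = - 1"
  by (simp add: slope_def)

lemma depth_pt:
  assumes "on e t" shows "depth (pt G e t) = h (fst (ends G e)) + slope e * t"
proof -
  have "\<bar>h (fst (ends G e)) - h (snd (ends G e))\<bar> = elen G e"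
    using height assms by (auto simp: height_function_def)
  then show ?thesis using elen_pos assms by (auto simp: depth_def pt_def slope_def split: if_splits)
qed

lemma depth_pt_diff:
  assumes "on e a" "on e b" shows "\<bar>depth (pt G e a) - depth (pt G e b)\<bar> = \<bar>a - b\<bar>"
  unfolding depth_pt[OF assms(1)] depth_pt[OF assms(2)] using slope_cases[of e] by auto

lemma pt_inj: "on e a \<Longrightarrow> on e b \<Longrightarrow> pt G e a = pt G e b \<Longrightarrow> a = b"
  using depth_pt_diff[of e a b] by simp

lemma depth_eq: "on e a \<Longrightarrow> on e b \<Longrightarrow> depth (pt G e a) = depth (pt G e b) \<Longrightarrow> a = b"
  using depth_pt_diff[of e a b] by simp

lemma between:
  assumes "on e a" "on e b" "on e c" "depth (pt G e b) \<le> depth (pt G e c)"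
    "depth (pt G e c) \<le> depth (pt G e a)"
  shows "c \<in> closed_segment a b"
  using assms slope_cases[of e] by (auto simp: depth_pt closed_segment_eq_real_ivl)

lemma on_segment: "on e a \<Longrightarrow> on e b \<Longrightarrow> c \<in> closed_segment a b \<Longrightarrow> on e c"
  by (auto simp: closed_segment_eq_real_ivl split: if_splits)

lemma segment_depth:
  assumes "on e a" "on e b" "c \<in> closed_segment a b" "depth (pt G e b) \<le> depth (pt G e a)"
  shows "depth (pt G e b) \<le> depth (pt G e c)" "depth (pt G e c) \<le> depth (pt G e a)"
  using assms on_segment[OF assms(1-3)] slope_cases[of e]
  by (auto simp: depth_pt closed_segment_eq_real_ivl split: if_splits)

text \<open>Combined with injectivity of \<open>lower\<close>, this shows that at most one edge
  leads strictly upwards from a vertex.\<close>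

lemma pt_lower:
  assumes "on e a" "on e b" "depth (pt G e b) < depth (pt G e a)" "pt G e a = Vtx v"
  shows "lower G h e = v"
proof -
  have "a = 0 \<or> a = elen G e" using assms(4) by (auto simp: pt_def split: if_splits)
  moreover have "slope e * b < slope e * a" using assms(3) depth_pt assms(1,2) by simp
  ultimately show ?thesis using assms(1,2,4) elen_pos[of e]
    by (auto simp: lower_def pt_def slope_def split: if_splits)
qed

text \<open>The ancestor order on all points, inner points of edges included: \<open>t\<close> is an
  ancestor of \<open>z\<close> when moves along single edges, none of them upwards, lead from
  \<open>t\<close> to \<open>z\<close>. The moves have the shape of those in \<open>walk\<close>, so
  the two inductions fit together.\<close>

inductive desc :: "('v, 'e) gpoint \<Rightarrow> ('v, 'e) gpoint \<Rightarrow> bool" for t where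
  desc_refl: "t \<in> points G \<Longrightarrow> desc t t"
| desc_step: "desc t (pt G e a) \<Longrightarrow> on e a \<Longrightarrow> on e b \<Longrightarrow> depth (pt G e a) \<le> depth (pt G e b)
    \<Longrightarrow> desc t (pt G e b)"

lemma desc_trans: "desc y z \<Longrightarrow> desc x y \<Longrightarrow> desc x z"
  by (induction rule: desc.induct) (auto intro: desc_step)

lemma desc_depth: "desc x y \<Longrightarrow> depth x \<le> depth y"
  by (induction rule: desc.induct) auto

lemma desc_eq: "desc x y \<Longrightarrow> depth y \<le> depth x \<Longrightarrow> x = y"
proof (induction rule: desc.induct)
  case (desc_step e a b)
  have "depth x \<le> depth (pt G e a)" using desc_depth[OF desc_step.hyps(1)] .
  then have "depth (pt G e a) = depth (pt G e b)" using desc_step.hyps(4) desc_step.prems by linarith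
  with depth_eq[OF desc_step.hyps(2,3)] have "a = b" .
  then show ?case using desc_step.IH desc_step.prems by blast
qed simp

lemma desc_points: "desc x y \<Longrightarrow> x \<in> points G"
  by (induction rule: desc.induct) auto

lemma desc_walk: "desc x y \<Longrightarrow> walk G UNIV x y (depth y - depth x)"
proof (induction rule: desc.induct)
  case (desc_step e a b)
  then have "walk G UNIV x (pt G e b) (depth (pt G e a) - depth x + \<bar>b - a\<bar>)"
    by (intro walk_step) auto
  moreover have "depth (pt G e a) - depth x + \<bar>b - a\<bar> = depth (pt G e b) - depth x"
    using desc_step depth_pt_diff[of e b a] by simp
  ultimately show ?case by simp
qed (simp add: walk_refl)

text \<open>The way up is forced: a climb from \<open>z\<close> retraces the last strict step of the
  descent from \<open>t\<close> to \<open>z\<close>, so it stays below \<open>t\<close> unless it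
  meets \<open>t\<close>.\<close>

lemma desc_boundary:
  "desc t z \<Longrightarrow> z = pt G e a \<Longrightarrow> on e a \<Longrightarrow> on e b \<Longrightarrow> depth (pt G e b) \<le> depth z
    \<Longrightarrow> desc t (pt G e b) \<or> t \<in> pt G e ` closed_segment a b"
proof (induction arbitrary: e a b rule: desc.induct)
  case desc_refl
  then show ?case by auto
next
  case (desc_step f a' b' e a b)
  let ?z = "pt G f b'" and ?z' = "pt G f a'" and ?w = "pt G e b"
  have z: "desc t ?z" using desc_step.hyps by (rule desc.desc_step)
  consider "depth ?w = depth ?z" | "?z' = ?z" | "depth ?w < depth ?z" "?z' \<noteq> ?z"
    using desc_step.prems by fastforce
  then show ?case
  proof cases
    case 1
    then have "b = a" using depth_eq[of e b a] desc_step.prems by simp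
    then show ?thesis using z desc_step.prems by simp
  next
    case 2
    then show ?thesis using desc_step.IH[of e a b] desc_step.prems by simp
  next
    case 3
    then have lt: "depth ?z' < depth ?z" using desc_step.hyps depth_eq[of f a' b'] by fastforce
    \<comment> \<open>If the edges differed, \<open>?z\<close> would be a vertex from which both
      lead strictly upwards.\<close>
    have "e = f"
    proof (rule ccontr)
      assume "e \<noteq> f"
      then obtain v where v: "?z = Vtx v"
        using desc_step.prems(1) by (auto simp: pt_def split: if_splits)
      then have "lower G h f = v" using pt_lower[of f b' a'] desc_step.hyps lt by simp
      moreover have "lower G h e = v" using pt_lower[of e a b] desc_step.prems 3 v by simp
      ultimately show False using \<open>e \<noteq> f\<close> height desc_step.hyps desc_step.prems
        by (auto simp: height_function_def dest: inj_onD)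
    qed
    then have a: "b' = a" using pt_inj desc_step.hyps desc_step.prems by blast
    \<comment> \<open>If \<open>?w\<close> is no higher than \<open>?z'\<close>, it is reached by
      descending from \<open>?z'\<close> on the same edge; otherwise the climb goes on from
      \<open>?z'\<close>, where the induction hypothesis applies.\<close>
    show ?thesis
    proof (cases "depth ?z' \<le> depth ?w")
      case True
      then show ?thesis using desc.desc_step[OF desc_step.hyps(1,2)] desc_step.prems \<open>e = f\<close> by blast
    next
      case False
      then have "desc t ?w \<or> t \<in> pt G e ` closed_segment a' b"
        using desc_step.IH[of e a' b] desc_step.prems desc_step.hyps \<open>e = f\<close> by simp
      moreover have "a' \<in> closed_segment a b"
        using between[of e a b a'] False lt desc_step.prems desc_step.hyps \<open>e = f\<close> a by simp
      then have "closed_segment a' b \<subseteq> closed_segment a b" by (simp add: subset_closed_segment)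
      ultimately show ?thesis by blast
    qed
  qed
qed

text \<open>Run the descent from \<open>x\<close> to \<open>z\<close> backwards: when an edge is
  climbed, \<open>y\<close> either remains an ancestor of the point reached or is met on that edge,
  and then \<open>y\<close> lies below \<open>x\<close>.\<close>

lemma desc_comparable: "desc x z \<Longrightarrow> desc y z \<Longrightarrow> desc x y \<or> desc y x"
proof (induction rule: desc.induct)
  case (desc_step e a b)
  have "desc y (pt G e a) \<or> y \<in> pt G e ` closed_segment b a"
    using desc_step by (intro desc_boundary) auto
  then show ?case
  proof
    assume "y \<in> pt G e ` closed_segment b a"
    then obtain c where c: "y = pt G e c" "c \<in> closed_segment b a" by blast
    then have "desc x y" using desc_step on_segment[of e b a c] segment_depth[of e b a c]
      unfolding c(1) by (intro desc.desc_step[of x e a c]) auto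
    then show ?thesis ..
  qed (rule desc_step.IH)
qed auto

text \<open>Only an upward step can leave the descendants of \<open>t\<close>, and by
  \<open>desc_boundary\<close> such a step contains \<open>t\<close>. Both parts stay in
  \<open>X\<close>: this is how \<open>t\<close> is shown to belong to a connected set.\<close>

lemma walk_leave:
  assumes "walk G X x y l" "desc t x"
  shows "desc t y \<or> (\<exists>l1 l2. walk G X x t l1 \<and> walk G X t y l2 \<and> l = l1 + l2)"
  using assms
proof (induction rule: walk.induct)
  case (walk_step e a l b)
  from walk_step.IH[OF walk_step.prems] show ?case
  proof
    assume desc: "desc t (pt G e a)"
    show ?thesis
    proof (cases "depth (pt G e a) \<le> depth (pt G e b)")
      case True
      then show ?thesis using desc_step[OF desc] walk_step.hyps by blast
    next
      case False
      then have "desc t (pt G e b) \<or> t \<in> pt G e ` closed_segment a b"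
        using desc walk_step.hyps by (intro desc_boundary) auto
      then show ?thesis
      proof
        assume "t \<in> pt G e ` closed_segment a b"
        then obtain c where c: "t = pt G e c" "c \<in> closed_segment a b" by blast
        then have sub: "closed_segment a c \<subseteq> closed_segment a b" "closed_segment c b \<subseteq> closed_segment a b"
          by (auto simp: subset_closed_segment)
        have on: "on e c" using on_segment c(2) walk_step.hyps by blast
        have "walk G X x t (l + \<bar>c - a\<bar>)"
          unfolding c(1) using walk_step.hyps on sub by (intro walk.walk_step) auto
        moreover have "walk G X t (pt G e b) \<bar>b - c\<bar>"
          unfolding c(1) using walk_step.hyps on sub by (intro walk_edge wf) auto
        moreover have "l + \<bar>b - a\<bar> = l + \<bar>c - a\<bar> + \<bar>b - c\<bar>"
          using c(2) by (auto simp: closed_segment_eq_real_ivl split: if_splits)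
        ultimately show ?thesis by blast
      qed simp
    qed
  next
    assume "\<exists>l1 l2. walk G X x t l1 \<and> walk G X t (pt G e a) l2 \<and> l = l1 + l2"
    then obtain l1 l2 where "walk G X x t l1" "walk G X t (pt G e a) l2" "l = l1 + l2" by blast
    moreover from this have "walk G X t (pt G e b) (l2 + \<bar>b - a\<bar>)"
      using walk_step.hyps by (intro walk.walk_step) auto
    ultimately show ?thesis by (intro disjI2 exI[of _ l1] exI[of _ "l2 + \<bar>b - a\<bar>"]) simp
  qed
qed simp

text \<open>The induction carries a common ancestor \<open>v\<close> of the start and the current
  point. It survives every step except a climb past \<open>v\<close>, after which the point reached
  takes its place.\<close>

lemma walk_meet:
  assumes "walk G X x y l"
  shows "\<exists>v. desc v x \<and> desc v y \<and> (depth x - depth v) + (depth y - depth v) \<le> l"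
  using assms
proof (induction rule: walk.induct)
  case walk_refl
  then show ?case by (intro exI[of _ x]) (auto intro: desc_refl)
next
  case (walk_step e a l b)
  then obtain v where v: "desc v x" "desc v (pt G e a)"
    "(depth x - depth v) + (depth (pt G e a) - depth v) \<le> l" by blast
  have on: "on e a" "on e b" using walk_step by auto
  note diff = depth_pt_diff[OF on(2,1)]
  show ?case
  proof (cases "depth (pt G e a) \<le> depth (pt G e b)")
    case True
    then show ?thesis using desc_step[OF v(2) on] v diff by (intro exI[of _ v]) auto
  next
    case False
    then have "desc v (pt G e b) \<or> v \<in> pt G e ` closed_segment a b"
      using v on by (intro desc_boundary) auto
    then show ?thesis
    proof
      assume "desc v (pt G e b)"
      then show ?thesis using v diff False by (intro exI[of _ v]) auto
    next
      assume "v \<in> pt G e ` closed_segment a b"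
      then obtain c where c: "v = pt G e c" "c \<in> closed_segment a b" by blast
      have onc: "on e c" using on_segment[OF on c(2)] .
      have le: "depth (pt G e b) \<le> depth v" "depth v \<le> depth (pt G e a)"
        using segment_depth[OF on c(2)] False c(1) by auto
      have "desc (pt G e b) v"
        unfolding c(1) using le c(1) on onc pt_in_points[OF wf]
        by (intro desc_step[of _ e b c] desc_refl) auto
      then have "desc (pt G e b) x" using desc_trans v(1) by blast
      then show ?thesis using v(3) diff False le on pt_in_points[OF wf]
        by (intro exI[of _ "pt G e b"]) (auto intro!: desc_refl)
    qed
  qed
qed

text \<open>A step that would leave the descendants of \<open>t\<close> ends no deeper than
  \<open>t\<close>; by minimality it ends at the same depth, and so at \<open>t\<close>
  itself.\<close>

lemma walk_desc_top:
  assumes "walk G X t a l" "\<And>z. z \<in> X \<Longrightarrow> depth t \<le> depth z" shows "desc t a"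
  using assms(1)
proof (induction rule: walk.induct)
  case (walk_step e a l b)
  then have on: "on e a" "on e b" by auto
  show ?case
  proof (cases "depth (pt G e a) \<le> depth (pt G e b)")
    case True
    then show ?thesis using desc_step[OF walk_step.IH on] by simp
  next
    case False
    then have "desc t (pt G e b) \<or> t \<in> pt G e ` closed_segment a b"
      using walk_step on by (intro desc_boundary) auto
    then show ?thesis
    proof
      assume "t \<in> pt G e ` closed_segment a b"
      then obtain c where c: "t = pt G e c" "c \<in> closed_segment a b" by blast
      then have onc: "on e c" using on_segment[OF on] by blast
      have "depth (pt G e b) \<le> depth t" using segment_depth[OF on c(2)] False c(1) by simp
      moreover have "depth t \<le> depth (pt G e b)" using assms(2) walk_step by auto
      ultimately have "c = b" using depth_eq[OF onc on(2)] c(1) by simp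
      then show ?thesis using c(1) desc_refl pt_in_points[OF wf] on by auto
    qed simp
  qed
qed (rule desc_refl)

section \<open>Conflicts between connected sets\<close>

definition conn :: "('v, 'e) gpoint set \<Rightarrow> bool" where
  "conn X \<longleftrightarrow> (\<forall>x\<in>X. \<forall>y\<in>X. \<exists>l. walk G X x y l)"

text \<open>A short walk from \<open>A\<close> to \<open>x\<close> in \<open>Q\<close> starts below
  \<open>t\<close>. If it leaves the part below \<open>t\<close>, its remainder from
  \<open>t\<close> is short too. If not, \<open>x\<close> is below \<open>t\<close> while
  \<open>q\<close> is no deeper than \<open>t\<close>, so connectedness forces \<open>t\<close> into
  \<open>Q\<close>.\<close>

lemma near_top:
  assumes "conn A" "t \<in> A" and top: "\<And>z. z \<in> A \<Longrightarrow> depth t \<le> depth z"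
    and "conn Q" "q \<in> Q" "depth q \<le> depth t" "0 < s" and near: "\<not> far G s A Q"
  obtains x l where "x \<in> Q" "walk G UNIV t x l" "l < s"
proof -
  obtain a x l where x: "a \<in> A" "x \<in> Q" "walk G UNIV a x l" "l < s"
    using near by (auto simp: far_def not_le)
  obtain l' where "walk G A t a l'" using assms(1,2) x(1) by (auto simp: conn_def)
  then have "desc t a" using walk_desc_top top by blast
  from walk_leave[OF x(3) this] show ?thesis
  proof
    assume "desc t x"
    obtain k where k: "walk G Q x q k" using assms(4,5) x(2) by (auto simp: conn_def)
    have "t \<in> Q" using walk_leave[OF k \<open>desc t x\<close>]
    proof
      assume "desc t q"
      then show ?thesis using desc_eq assms(5,6) by blast
    qed (auto dest: walk_mem)
    moreover have "walk G UNIV t t 0" using desc_points[OF \<open>desc t a\<close>] by (auto intro: walk_refl)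
    ultimately show ?thesis using that \<open>0 < s\<close> by blast
  next
    assume "\<exists>l1 l2. walk G UNIV a t l1 \<and> walk G UNIV t x l2 \<and> l = l1 + l2"
    then obtain l1 l2 where l: "walk G UNIV a t l1" "walk G UNIV t x l2" "l = l1 + l2" by blast
    then have "l2 < s" using x(4) walk_mem(4)[OF l(1)] by simp
    then show ?thesis using that l(2) x(2) by blast
  qed
qed

text \<open>On its way from \<open>x\<close> to \<open>q\<close>, the set \<open>Q\<close> either
  stays below \<open>v\<close> or contains \<open>v\<close>. Either way it has a point
  \<open>x'\<close> below \<open>w\<close> and no deeper than \<open>t\<close>, so the route from
  \<open>x'\<close> to \<open>y\<close> through \<open>w\<close> is at most as long as the one from
  \<open>t\<close>.\<close>

lemma near_of_meets:
  assumes "conn Q" "x \<in> Q" "q \<in> Q" "depth q \<le> depth t" "y \<in> Q'"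
    and v: "desc v t" "desc v x" and w: "desc w t" "desc w y"
    and short: "(depth t - depth w) + (depth y - depth w) < s" and "desc w v"
  shows "\<not> far G s Q Q'"
proof -
  obtain k where k: "walk G Q x q k" using assms(1-3) by (auto simp: conn_def)
  have "\<exists>x'\<in>Q. desc w x' \<and> depth x' \<le> depth t"
    using walk_leave[OF k v(2)]
  proof
    assume "desc v q"
    then show ?thesis using assms(3,4) desc_trans[OF _ \<open>desc w v\<close>] by blast
  next
    assume "\<exists>l1 l2. walk G Q x v l1 \<and> walk G Q v q l2 \<and> k = l1 + l2"
    then have "v \<in> Q" by (auto dest: walk_mem)
    then show ?thesis using \<open>desc w v\<close> desc_depth[OF v(1)] by blast
  qed
  then obtain x' where x': "x' \<in> Q" "desc w x'" "depth x' \<le> depth t" by blast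
  have "walk G UNIV x' y ((depth x' - depth w) + (depth y - depth w))"
    using walk_trans[OF desc_walk[OF w(2)] walk_sym[OF wf desc_walk[OF x'(2)]]] .
  moreover have "(depth x' - depth w) + (depth y - depth w) < s" using short x'(3) by simp
  ultimately show ?thesis using x'(1) assms(5) unfolding far_def by (meson not_le)
qed

text \<open>A connected set at distance less than \<open>s\<close> from \<open>A\<close> and not entirely below the top of \<open>A\<close>
  comes within \<open>s\<close> of that top; two such sets branch off the ancestors of the top of \<open>A\<close>, and the
  one that branches off lower is at least as close to the other one as the top of \<open>A\<close> is.\<close>

lemma conflict_unique:
  assumes "0 < s" "conn A" "t \<in> A" "\<And>z. z \<in> A \<Longrightarrow> depth t \<le> depth z"
    and Q: "conn Q" "q \<in> Q" "depth q \<le> depth t" "\<not> far G s A Q"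
    and Q': "conn Q'" "q' \<in> Q'" "depth q' \<le> depth t" "\<not> far G s A Q'"
  shows "\<not> far G s Q Q'"
proof -
  obtain x l where x: "x \<in> Q" "walk G UNIV t x l" "l < s"
    using near_top[OF assms(2-4) Q(1-3) assms(1) Q(4)] by blast
  obtain y k where y: "y \<in> Q'" "walk G UNIV t y k" "k < s"
    using near_top[OF assms(2-4) Q'(1-3) assms(1) Q'(4)] by blast
  obtain v where v: "desc v t" "desc v x" "(depth t - depth v) + (depth x - depth v) < s"
    using walk_meet[OF x(2)] x(3) by (meson le_less_trans)
  obtain w where w: "desc w t" "desc w y" "(depth t - depth w) + (depth y - depth w) < s"
    using walk_meet[OF y(2)] y(3) by (meson le_less_trans)
  from desc_comparable[OF v(1) w(1)] show ?thesis
  proof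
    assume "desc w v"
    then show ?thesis using near_of_meets[OF Q(1) x(1) Q(2,3) y(1) v(1,2) w] by blast
  next
    assume "desc v w"
    then have "\<not> far G s Q' Q" using near_of_meets[OF Q'(1) y(1) Q'(2,3) x(1) w(1,2) v] by blast
    then show ?thesis using far_sym[OF wf] by blast
  qed
qed

section \<open>Deepest tops and the greedy allocation\<close>

definition topped :: "('v, 'e) gpoint set \<Rightarrow> bool" where
  "topped X \<longleftrightarrow> X = {} \<or> (\<exists>t\<in>X. \<forall>z\<in>X. depth t \<le> depth z)"

text \<open>An empty piece conflicts with nothing and can be chosen outright. Otherwise all tops
  exist and a deepest one is chosen, so that \<open>conflict_unique\<close> applies to any two
  pieces of one agent.\<close>

lemma deepest_piece:
  fixes P :: "nat \<Rightarrow> nat \<Rightarrow> ('v, 'e) gpoint set"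
  assumes "finite S" "S \<noteq> {}" "0 < s"
    and J: "\<And>i. i \<in> S \<Longrightarrow> finite (J i) \<and> J i \<noteq> {}"
    and P: "\<And>i j. i \<in> S \<Longrightarrow> j \<in> J i \<Longrightarrow> conn (P i j) \<and> topped (P i j)"
    and far: "\<And>i j k. i \<in> S \<Longrightarrow> j \<in> J i \<Longrightarrow> k \<in> J i \<Longrightarrow> j \<noteq> k \<Longrightarrow> far G s (P i j) (P i k)"
  obtains i j where "i \<in> S" "j \<in> J i"
    "\<And>k. k \<in> S \<Longrightarrow> card {l \<in> J k. \<not> far G s (P i j) (P k l)} \<le> 1"
proof (cases "\<exists>i\<in>S. \<exists>j\<in>J i. P i j = {}")
  case True
  then obtain i j where "i \<in> S" "j \<in> J i" "P i j = {}" by blast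
  then show ?thesis using that by (simp add: far_def)
next
  case False
  define T where "T = Sigma S J"
  have "finite T" "T \<noteq> {}" using assms(1,2) J by (auto simp: T_def)
  have "\<forall>ij\<in>T. \<exists>t. t \<in> P (fst ij) (snd ij) \<and> (\<forall>z\<in>P (fst ij) (snd ij). depth t \<le> depth z)"
    using P False by (fastforce simp: T_def topped_def)
  then obtain top where top: "\<And>i j. (i, j) \<in> T \<Longrightarrow> top (i, j) \<in> P i j"
      "\<And>i j z. (i, j) \<in> T \<Longrightarrow> z \<in> P i j \<Longrightarrow> depth (top (i, j)) \<le> depth z"
    by (metis fst_conv snd_conv)
  define M where "M = Max ((\<lambda>ij. depth (top ij)) ` T)"
  have "M \<in> (\<lambda>ij. depth (top ij)) ` T" unfolding M_def using \<open>finite T\<close> \<open>T \<noteq> {}\<close> by (intro Max_in) auto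
  then obtain i j where ij: "(i, j) \<in> T" "depth (top (i, j)) = M" by auto
  have max: "depth (top kl) \<le> depth (top (i, j))" if "kl \<in> T" for kl
    unfolding ij(2) M_def using \<open>finite T\<close> that by (intro Max_ge) auto
  have "card {l \<in> J k. \<not> far G s (P i j) (P k l)} \<le> 1" if k: "k \<in> S" for k
  proof -
    have "l = l'" if l: "l \<in> J k" "\<not> far G s (P i j) (P k l)" "l' \<in> J k" "\<not> far G s (P i j) (P k l')" for l l'
    proof (rule ccontr)
      assume "l \<noteq> l'"
      have T: "(k, l) \<in> T" "(k, l') \<in> T" using k l by (auto simp: T_def)
      have "\<not> far G s (P k l) (P k l')"
        using conflict_unique[OF \<open>0 < s\<close> _ top(1)[OF ij(1)] top(2)[OF ij(1)]
            _ top(1)[OF T(1)] max[OF T(1)] l(2) _ top(1)[OF T(2)] max[OF T(2)] l(4)]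
          P ij(1) k l by (auto simp: T_def)
      then show False using far k l \<open>l \<noteq> l'\<close> by blast
    qed
    then show ?thesis using J[OF k] by (simp add: card_le_Suc0_iff_eq)
  qed
  then show ?thesis using that ij(1) by (auto simp: T_def)
qed

text \<open>The index sets \<open>J i\<close> hold the pieces still available to agent
  \<open>i\<close>. The invariant \<open>card S \<le> card (J i)\<close> survives a round because
  \<open>S\<close> loses one agent and each remaining \<open>J k\<close> at most one index.\<close>

lemma greedy_allocation:
  fixes P :: "nat \<Rightarrow> nat \<Rightarrow> ('v, 'e) gpoint set"
  assumes "finite S" "0 < s"
    and "\<And>i. i \<in> S \<Longrightarrow> card S \<le> card (J i)"
    and "\<And>i j. i \<in> S \<Longrightarrow> j \<in> J i \<Longrightarrow> conn (P i j) \<and> topped (P i j)"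
    and "\<And>i j k. i \<in> S \<Longrightarrow> j \<in> J i \<Longrightarrow> k \<in> J i \<Longrightarrow> j \<noteq> k \<Longrightarrow> far G s (P i j) (P i k)"
  shows "\<exists>f. (\<forall>i\<in>S. f i \<in> J i) \<and> (\<forall>i\<in>S. \<forall>k\<in>S. i \<noteq> k \<longrightarrow> far G s (P i (f i)) (P k (f k)))"
  using assms
proof (induction "card S" arbitrary: S J)
  case 0
  then show ?case by simp
next
  case (Suc n)
  have fin: "finite (J i) \<and> J i \<noteq> {}" if "i \<in> S" for i
  proof -
    have "card (J i) > 0" using Suc.hyps(2) Suc.prems(3)[OF that] by linarith
    then show ?thesis using card_gt_0_iff by blast
  qed
  have "S \<noteq> {}" using Suc.hyps(2) by auto
  obtain i j where ij: "i \<in> S" "j \<in> J i"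
    and few: "\<And>k. k \<in> S \<Longrightarrow> card {l \<in> J k. \<not> far G s (P i j) (P k l)} \<le> 1"
    using deepest_piece[of S s J P, OF Suc.prems(1) \<open>S \<noteq> {}\<close> Suc.prems(2) fin Suc.prems(4) Suc.prems(5)] by blast
  define J' where "J' = (\<lambda>k. {l \<in> J k. far G s (P i j) (P k l)})"
  have card: "n = card (S - {i})" using ij Suc.hyps(2) Suc.prems(1) by simp
  have "card (S - {i}) \<le> card (J' k)" if k: "k \<in> S - {i}" for k
  proof -
    have "J k = J' k \<union> {l \<in> J k. \<not> far G s (P i j) (P k l)}" by (auto simp: J'_def)
    then have "card (J k) \<le> card (J' k) + card {l \<in> J k. \<not> far G s (P i j) (P k l)}"
      by (metis card_Un_le)
    then show ?thesis using few[of k] k Suc.prems(3)[of k] Suc.hyps(2) card by simp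
  qed
  then have "\<exists>f. (\<forall>k\<in>S - {i}. f k \<in> J' k) \<and>
      (\<forall>k\<in>S - {i}. \<forall>l\<in>S - {i}. k \<noteq> l \<longrightarrow> far G s (P k (f k)) (P l (f l)))"
    using Suc.prems by (intro Suc.hyps(1)[OF card]) (auto simp: J'_def)
  then obtain f where f: "\<forall>k\<in>S - {i}. f k \<in> J' k"
      "\<forall>k\<in>S - {i}. \<forall>l\<in>S - {i}. k \<noteq> l \<longrightarrow> far G s (P k (f k)) (P l (f l))" by blast
  have "far G s (P i j) (P k (f k))" "far G s (P k (f k)) (P i j)" if "k \<in> S" "k \<noteq> i" for k
    using f(1) that far_sym[OF wf] by (auto simp: J'_def)
  then show ?case using f ij by (intro exI[of _ "f(i := j)"]) (auto simp: J'_def)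
qed

section \<open>Limits of connected pieces\<close>

definition slice :: "('v, 'e) gpoint set \<Rightarrow> 'e \<Rightarrow> real set" where
  "slice X e = {t \<in> {0..elen G e}. pt G e t \<in> X}"

text \<open>The default 0 for an empty slice keeps \<open>lo\<close> and \<open>hi\<close> inside
  the edge for every set, so all sequences of such values are bounded.\<close>

definition lo :: "('v, 'e) gpoint set \<Rightarrow> 'e \<Rightarrow> real" where
  "lo X e = (if slice X e = {} then 0 else Inf (slice X e))"

definition hi :: "('v, 'e) gpoint set \<Rightarrow> 'e \<Rightarrow> real" where
  "hi X e = (if slice X e = {} then 0 else Sup (slice X e))"

lemma slice_bounded: "bdd_below (slice X e)" "bdd_above (slice X e)"
  by (auto simp: slice_def intro: bdd_belowI[of _ 0] bdd_aboveI[of _ "elen G e"])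

lemma slice_lo_hi: "t \<in> slice X e \<Longrightarrow> lo X e \<le> t \<and> t \<le> hi X e"
  using slice_bounded[of X e] by (auto simp: lo_def hi_def intro: cInf_lower cSup_upper)

lemma lo_hi_range:
  assumes "e \<in> edges G" shows "0 \<le> lo X e" "lo X e \<le> hi X e" "hi X e \<le> elen G e"
proof -
  show "0 \<le> lo X e" by (auto simp: lo_def slice_def intro!: cInf_greatest)
  show "hi X e \<le> elen G e" using elen_pos[OF assms] by (auto simp: hi_def slice_def intro!: cSup_least)
  show "lo X e \<le> hi X e"
    using slice_lo_hi[of _ X e] by (cases "slice X e = {}") (auto simp: lo_def hi_def, force)
qed

text \<open>Of \<open>a\<close> and \<open>b\<close>, the deeper point is a descendant of the point
  at \<open>c\<close> and the other is not; the walk inside \<open>X\<close> that joins them must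
  pass through it.\<close>

lemma conn_slice_between:
  assumes "conn X" "e \<in> edges G" "a \<in> slice X e" "b \<in> slice X e" "a \<le> c" "c \<le> b"
  shows "c \<in> slice X e"
proof -
  have on: "on e a" "on e b" "on e c" using assms by (auto simp: slice_def)
  have main: "c \<in> slice X e"
    if xy: "x \<in> slice X e" "y \<in> slice X e" "on e x" "on e y"
      and d: "depth (pt G e x) < depth (pt G e c)" "depth (pt G e c) \<le> depth (pt G e y)" for x y
  proof -
    have "desc (pt G e c) (pt G e y)"
      using xy d on(3) pt_in_points[OF wf] by (intro desc_step[of _ e c y] desc_refl) auto
    moreover obtain l where "walk G X (pt G e y) (pt G e x) l"
      using assms(1) xy by (auto simp: conn_def slice_def)
    moreover have "\<not> desc (pt G e c) (pt G e x)" using d(1) desc_depth by fastforce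
    ultimately have "pt G e c \<in> X" using walk_leave by (blast dest: walk_mem)
    then show ?thesis using on(3) by (simp add: slice_def)
  qed
  show ?thesis
  proof (cases "c = a \<or> c = b")
    case False
    then have "a < c" "c < b" using assms(5,6) by auto
    then have "depth (pt G e a) < depth (pt G e c) \<and> depth (pt G e c) \<le> depth (pt G e b) \<or>
        depth (pt G e b) < depth (pt G e c) \<and> depth (pt G e c) \<le> depth (pt G e a)"
      unfolding depth_pt[OF on(1)] depth_pt[OF on(2)] depth_pt[OF on(3)] using slope_cases[of e] by auto
    then show ?thesis using main assms(3,4) on by blast
  qed (use assms(3,4) in auto)
qed

lemma conn_slice_interior:
  assumes "conn X" "e \<in> edges G" "slice X e \<noteq> {}" "lo X e < c" "c < hi X e"
  shows "c \<in> slice X e"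
proof -
  have "Inf (slice X e) < c" "c < Sup (slice X e)" using assms(3-5) by (simp_all add: lo_def hi_def)
  then obtain a b where "a \<in> slice X e" "a < c" "b \<in> slice X e" "c < b"
    using cInf_lessD[OF assms(3)] less_cSupD[OF assms(3)] by blast
  then show ?thesis using conn_slice_between[OF assms(1,2), of a b c] by simp
qed

end

text \<open>Holds for arbitrary \<open>D\<close> since \<open>measure\<close> is 0 on non-measurable
  sets. Reversed bounds give an empty interval, which the absolute value covers.\<close>

lemma measure_two_intervals:
  fixes D :: "real set"
  assumes "D \<subseteq> {a..b} \<union> {c..d}" shows "measure lebesgue D \<le> \<bar>b - a\<bar> + \<bar>d - c\<bar>"
proof (cases "D \<in> sets lebesgue")
  case True
  have "measure lebesgue D \<le> measure lebesgue ({a..b} \<union> {c..d})"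
    using assms True by (intro measure_mono_fmeasurable) auto
  also have "\<dots> \<le> measure lebesgue {a..b} + measure lebesgue {c..d}"
    by (intro measure_Un_le) auto
  also have "\<dots> \<le> \<bar>b - a\<bar> + \<bar>d - c\<bar>" by simp
  finally show ?thesis .
next
  case False
  then show ?thesis by (simp add: measure_notin_sets)
qed

section \<open>The limit of a sequence of connected pieces of constant combinatorial type\<close>

locale piece_limit = height_forest +
  fixes X :: "nat \<Rightarrow> ('a, 'b) gpoint set" and \<alpha> \<beta> :: "'b \<Rightarrow> real" and E :: "'b set" and W :: "'a set"
  assumes X_points: "X m \<subseteq> points G" and X_conn: "conn (X m)"
    and E_edges: "E \<subseteq> edges G" and W_verts: "W \<subseteq> verts G"
    and lo_lim: "e \<in> edges G \<Longrightarrow> (\<lambda>m. lo (X m) e) \<longlonglongrightarrow> \<alpha> e"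
    and hi_lim: "e \<in> edges G \<Longrightarrow> (\<lambda>m. hi (X m) e) \<longlonglongrightarrow> \<beta> e"
    and E_iff: "e \<in> edges G \<Longrightarrow> slice (X m) e \<noteq> {} \<longleftrightarrow> e \<in> E"
    and W_iff: "w \<in> verts G \<Longrightarrow> Vtx w \<in> X m \<longleftrightarrow> w \<in> W"
begin

text \<open>The intervals are closed, so \<open>L\<close> may contain vertices that lie in no
  \<open>X m\<close>. The set \<open>W\<close> also supplies isolated vertices, which no slice
  records.\<close>

definition L :: "('a, 'b) gpoint set" where
  "L = (\<Union>e\<in>E. pt G e ` {\<alpha> e..\<beta> e}) \<union> Vtx ` W"

lemma ends_verts: "e \<in> edges G \<Longrightarrow> fst (ends G e) \<in> verts G \<and> snd (ends G e) \<in> verts G"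
  using wf by (auto simp: wf_cgraph_def)

lemma \<alpha>\<beta>:
  assumes "e \<in> edges G" shows "0 \<le> \<alpha> e" "\<alpha> e \<le> \<beta> e" "\<beta> e \<le> elen G e"
  using lo_hi_range[OF assms]
  by (auto intro: LIMSEQ_le_const[OF lo_lim[OF assms]] LIMSEQ_le_const2[OF hi_lim[OF assms]]
      LIMSEQ_le[OF lo_lim[OF assms] hi_lim[OF assms]])

lemma piece_L: "piece G L"
  unfolding piece_def
proof (intro exI conjI)
  show "finite ((\<lambda>e. (e, {\<alpha> e..\<beta> e})) ` E)"
    using wf E_edges by (auto simp: wf_cgraph_def intro: finite_subset)
  show "\<forall>(e, I)\<in>(\<lambda>e. (e, {\<alpha> e..\<beta> e})) ` E. e \<in> edges G \<and> is_interval I \<and> I \<subseteq> {0..elen G e}"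
    using E_edges \<alpha>\<beta> by (auto simp: is_interval_cc subset_iff intro: order_trans)
qed (use W_verts in \<open>auto simp: L_def\<close>)

lemma L_edge: "e \<in> E \<Longrightarrow> t \<in> {\<alpha> e..\<beta> e} \<Longrightarrow> pt G e t \<in> L"
  unfolding L_def by blast

lemma L_points: "L \<subseteq> points G"
  using piece_points[OF wf piece_L] .

text \<open>Depth is monotone along an edge, so on a closed interval it is least at an end. Finitely
  many candidates remain: the interval ends and the vertices in \<open>W\<close>.\<close>

lemma topped_L: "topped L"
proof (cases "L = {}")
  case False
  define C where "C = (\<lambda>e. pt G e (\<alpha> e)) ` E \<union> (\<lambda>e. pt G e (\<beta> e)) ` E \<union> Vtx ` W"
  have on: "on e t" if "e \<in> E" "\<alpha> e \<le> t" "t \<le> \<beta> e" for e t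
    using that E_edges \<alpha>\<beta>[of e] by auto
  have sub: "C \<subseteq> L" unfolding C_def using E_edges \<alpha>\<beta> by (auto intro!: L_edge) (auto simp: L_def)
  have C: "\<exists>c\<in>C. depth c \<le> depth z" if z: "z \<in> L" for z
  proof -
    from z consider w where "w \<in> W" "z = Vtx w"
      | e t where "e \<in> E" "\<alpha> e \<le> t" "t \<le> \<beta> e" "z = pt G e t" by (auto simp: L_def)
    then show ?thesis
    proof cases
      case 2
      then have "depth (pt G e (\<alpha> e)) \<le> depth z \<or> depth (pt G e (\<beta> e)) \<le> depth z"
        using slope_cases[of e] on[OF 2(1), of t] on[OF 2(1), of "\<alpha> e"] on[OF 2(1), of "\<beta> e"]
        by (auto simp: depth_pt)
      then show ?thesis using 2(1) by (auto simp: C_def)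
    qed (auto simp: C_def)
  qed
  have "finite C" "C \<noteq> {}"
    using C False wf E_edges W_verts
    by (auto simp: C_def wf_cgraph_def intro: finite_subset)
  then obtain c where c: "c \<in> C" "\<And>c'. c' \<in> C \<Longrightarrow> depth c \<le> depth c'"
    using ex_min_if_finite[of "depth ` C"] by (auto simp: not_less)
  have "depth c \<le> depth z" if "z \<in> L" for z using C[OF that] c(2) by fastforce
  then show ?thesis using c(1) sub by (auto simp: topped_def)
qed (simp add: topped_def)

text \<open>The point is a vertex, and which vertices belong to \<open>X m\<close> does not vary
  with \<open>m\<close>. So it lies in all slices on \<open>e\<close> and stays between the limits
  of \<open>lo\<close> and \<open>hi\<close>.\<close>

lemma slice_end:
  assumes "e \<in> E" "t \<in> slice (X m) e" "t = 0 \<or> t = elen G e" shows "t \<in> {\<alpha> e..\<beta> e}"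
proof -
  have e: "e \<in> edges G" using assms(1) E_edges by auto
  have "pt G e t = Vtx (fst (ends G e)) \<or> pt G e t = Vtx (snd (ends G e))"
    using assms(3) by (auto simp: pt_def)
  then have "\<forall>m. pt G e t \<in> X m"
    using assms(2) W_iff[of "fst (ends G e)"] W_iff[of "snd (ends G e)"] ends_verts[OF e]
    by (auto simp: slice_def)
  then have "\<forall>m. t \<in> slice (X m) e" using assms(2) by (auto simp: slice_def)
  then have "\<forall>m. lo (X m) e \<le> t \<and> t \<le> hi (X m) e" using slice_lo_hi by blast
  then show ?thesis using LIMSEQ_le_const[OF hi_lim[OF e]] LIMSEQ_le_const2[OF lo_lim[OF e]] by auto
qed

lemma edge_walk:
  assumes "e \<in> E" "a \<in> {\<alpha> e..\<beta> e}" "b \<in> {\<alpha> e..\<beta> e}"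
  shows "walk G L (pt G e a) (pt G e b) \<bar>b - a\<bar>"
proof (rule walk_edge[OF wf])
  have "closed_segment a b \<subseteq> {\<alpha> e..\<beta> e}"
    using assms by (auto simp: closed_segment_eq_real_ivl split: if_splits)
  then show "pt G e ` closed_segment a b \<subseteq> L" using assms(1) by (auto simp: L_def)
qed (use assms E_edges \<alpha>\<beta>[of e] in auto)

text \<open>Collapses the part of \<open>X m\<close> inside an edge to one point of the limit on that edge.\<close>

definition rep :: "('a, 'b) gpoint \<Rightarrow> ('a, 'b) gpoint" where
  "rep z = (case z of Vtx u \<Rightarrow> Vtx u | Inn e t \<Rightarrow> pt G e (\<alpha> e))"

lemma rep_pt:
  assumes "e \<in> edges G" "t \<in> slice (X m) e"
  shows "e \<in> E" "\<exists>c\<in>{\<alpha> e..\<beta> e}. rep (pt G e t) = pt G e c"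
proof -
  show "e \<in> E" using E_iff[OF assms(1)] assms(2) by blast
  show "\<exists>c\<in>{\<alpha> e..\<beta> e}. rep (pt G e t) = pt G e c"
  proof (cases "t = 0 \<or> t = elen G e")
    case True
    then show ?thesis using slice_end[OF \<open>e \<in> E\<close> assms(2)]
      by (intro bexI[of _ t]) (auto simp: rep_def pt_def)
  next
    case False
    then show ?thesis using \<alpha>\<beta>[OF assms(1)]
      by (intro bexI[of _ "\<alpha> e"]) (auto simp: rep_def pt_def)
  qed
qed

lemma rep_in_L:
  assumes "z \<in> X m" shows "rep z \<in> L"
proof (cases z)
  case (Vtx u)
  then have "u \<in> verts G" using assms X_points[of m] by (auto simp: points_def)
  then show ?thesis using assms Vtx W_iff by (auto simp: rep_def L_def)
next
  case (Inn e t)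
  then have e: "e \<in> edges G" "0 < t" "t < elen G e" using assms X_points[of m] by (auto simp: points_def)
  then have "t \<in> slice (X m) e" "z = pt G e t" using assms Inn by (auto simp: slice_def pt_def)
  then show ?thesis using rep_pt[OF e(1)] by (fastforce simp: L_def)
qed

text \<open>A step runs along one edge, so both of its images lie in the limit interval of that
  edge. Vertices are fixed, which lets the image pass from edge to edge. Lengths are not
  preserved.\<close>

lemma rep_walk:
  assumes "walk G (X m) x y l" shows "\<exists>l. walk G L (rep x) (rep y) l"
  using assms
proof (induction rule: walk.induct)
  case walk_refl
  then have "rep x \<in> L" by (intro rep_in_L)
  then show ?case using L_points walk.walk_refl by blast
next
  case (walk_step e a l b)
  then obtain k where k: "walk G L (rep x) (rep (pt G e a)) k" by blast
  have "a \<in> slice (X m) e" "b \<in> slice (X m) e" using walk_step by (auto simp: slice_def)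
  then obtain c d where "e \<in> E" "c \<in> {\<alpha> e..\<beta> e}" "rep (pt G e a) = pt G e c"
      "d \<in> {\<alpha> e..\<beta> e}" "rep (pt G e b) = pt G e d"
    using rep_pt[OF walk_step.hyps(2)] by blast
  then have "walk G L (rep (pt G e a)) (rep (pt G e b)) \<bar>d - c\<bar>" using edge_walk by simp
  then show ?case using k walk_trans by blast
qed

text \<open>As the type is constant, \<open>X 0\<close> already meets every edge in \<open>E\<close>
  and contains every vertex in \<open>W\<close>.\<close>

lemma L_to_rep:
  assumes "p \<in> L" shows "\<exists>z\<in>X 0. \<exists>l. walk G L p (rep z) l"
proof -
  from assms consider w where "w \<in> W" "p = Vtx w"
    | e t where "e \<in> E" "t \<in> {\<alpha> e..\<beta> e}" "p = pt G e t" by (auto simp: L_def)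
  then show ?thesis
  proof cases
    case 1
    have "walk G L p p 0" using assms L_points by (auto intro: walk_refl)
    then show ?thesis using 1 W_iff[of w 0] W_verts
      by (intro bexI[of _ "Vtx w"]) (auto simp: rep_def)
  next
    case 2
    then have e: "e \<in> edges G" using E_edges by auto
    then obtain c where c: "c \<in> slice (X 0) e" using E_iff[OF e, of 0] 2(1) by blast
    then obtain d where "d \<in> {\<alpha> e..\<beta> e}" "rep (pt G e c) = pt G e d" using rep_pt[OF e] by blast
    then show ?thesis using edge_walk[OF 2(1,2)] 2(3) c
      by (intro bexI[of _ "pt G e c"]) (auto simp: slice_def)
  qed
qed

lemma conn_L: "conn L"
  unfolding conn_def
proof (intro ballI)
  fix p q assume "p \<in> L" "q \<in> L"
  then obtain y z k l where yz: "y \<in> X 0" "z \<in> X 0" and k: "walk G L p (rep y) k" and l: "walk G L q (rep z) l"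
    using L_to_rep by meson
  obtain i where "walk G (X 0) y z i" using X_conn[of 0] yz by (auto simp: conn_def)
  then obtain j where "walk G L (rep y) (rep z) j" using rep_walk by blast
  then show "\<exists>l. walk G L p q l" using walk_trans walk_sym[OF wf l] k by blast
qed

text \<open>Strictly between \<open>lo\<close> and \<open>hi\<close> the slice contains
  \<open>t\<close> itself. Otherwise \<open>t\<close> is within \<open>\<epsilon>\<close> of the
  infimum or the supremum, which the slice approaches even if it omits it.\<close>

lemma slice_approx:
  assumes "e \<in> E" "t \<in> {\<alpha> e..\<beta> e}" "0 < \<epsilon>"
  shows "eventually (\<lambda>m. \<exists>t'\<in>slice (X m) e. \<bar>t' - t\<bar> < \<epsilon>) sequentially"
proof -
  have e: "e \<in> edges G" using assms(1) E_edges by auto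
  have "eventually (\<lambda>m. lo (X m) e < \<alpha> e + \<epsilon>) sequentially"
    using order_tendstoD(2)[OF lo_lim[OF e]] assms(3) by simp
  moreover have "eventually (\<lambda>m. \<beta> e - \<epsilon> < hi (X m) e) sequentially"
    using order_tendstoD(1)[OF hi_lim[OF e]] assms(3) by simp
  ultimately show ?thesis
  proof eventually_elim
    case (elim m)
    have ne: "slice (X m) e \<noteq> {}" using E_iff[OF e] assms(1) by blast
    consider "t \<le> lo (X m) e" | "hi (X m) e \<le> t" | "lo (X m) e < t" "t < hi (X m) e" by linarith
    then show ?case
    proof cases
      case 1
      have "Inf (slice (X m) e) < t + \<epsilon>" using elim(1) assms(2) ne by (simp add: lo_def)
      then obtain t' where "t' \<in> slice (X m) e" "t' < t + \<epsilon>" using cInf_lessD[OF ne] by blast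
      then show ?thesis using slice_lo_hi 1 by (intro bexI[of _ t']) force+
    next
      case 2
      have "t - \<epsilon> < Sup (slice (X m) e)" using elim(2) assms(2) ne by (simp add: hi_def)
      then obtain t' where "t' \<in> slice (X m) e" "t - \<epsilon> < t'" using less_cSupD[OF ne] by blast
      then show ?thesis using slice_lo_hi 2 by (intro bexI[of _ t']) force+
    next
      case 3
      then have "t \<in> slice (X m) e" using conn_slice_interior[OF X_conn e ne] by blast
      then show ?thesis using assms(3) by (intro bexI[of _ t]) auto
    qed
  qed
qed

lemma L_approx:
  assumes "p \<in> L" "0 < \<epsilon>"
  shows "eventually (\<lambda>m. \<exists>z\<in>X m. \<exists>l<\<epsilon>. walk G UNIV z p l) sequentially"
proof -
  from assms consider w where "w \<in> W" "p = Vtx w"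
    | e t where "e \<in> E" "t \<in> {\<alpha> e..\<beta> e}" "p = pt G e t" by (auto simp: L_def)
  then show ?thesis
  proof cases
    case 1
    have "walk G UNIV p p 0" using assms(1) L_points by (auto intro: walk_refl)
    then show ?thesis using 1 W_iff[of w] W_verts assms(2) by (intro always_eventually) blast
  next
    case 2
    have e: "e \<in> edges G" using 2(1) E_edges by auto
    show ?thesis using slice_approx[OF 2(1,2) assms(2)]
    proof eventually_elim
      case (elim m)
      then obtain t' where t': "t' \<in> slice (X m) e" "\<bar>t' - t\<bar> < \<epsilon>" by blast
      have "walk G UNIV (pt G e t') p \<bar>t - t'\<bar>"
        unfolding 2(3) using 2(2) t'(1) e \<alpha>\<beta>[OF e] by (intro walk_edge[OF wf]) (auto simp: slice_def)
      then show ?case using t' by (intro bexI[of _ "pt G e t'"]) (auto simp: slice_def abs_minus_commute)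
    qed
  qed
qed

lemma Inn_in_L:
  assumes "e \<in> edges G" "0 < t" "t < elen G e"
  shows "Inn e t \<in> L \<longleftrightarrow> e \<in> E \<and> \<alpha> e \<le> t \<and> t \<le> \<beta> e"
proof
  assume "e \<in> E \<and> \<alpha> e \<le> t \<and> t \<le> \<beta> e"
  moreover have "pt G e t = Inn e t" using assms by (simp add: pt_def)
  ultimately show "Inn e t \<in> L" unfolding L_def by force
qed (auto simp: L_def pt_def split: if_splits)

text \<open>On an edge, \<open>L\<close> and \<open>X m\<close> differ only between corresponding
  interval ends. Each of the two set differences is bounded by the displacement of these ends,
  whence the factor 2.\<close>

lemma plen_diff_le:
  "plen G (L - X m) + plen G (X m - L) \<le>
    (\<Sum>e\<in>edges G. 2 * (\<bar>lo (X m) e - \<alpha> e\<bar> + \<bar>hi (X m) e - \<beta> e\<bar>))"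
  unfolding plen_def sum.distrib[symmetric]
proof (rule sum_mono)
  fix e assume e: "e \<in> edges G"
  let ?l = "lo (X m) e" and ?h = "hi (X m) e"
  have cut: "Inn e t \<in> X m \<longleftrightarrow> t \<in> slice (X m) e" if "0 < t" "t < elen G e" for t
    using that by (auto simp: slice_def pt_def)
  have "{t. 0 < t \<and> t < elen G e \<and> Inn e t \<in> L - X m} \<subseteq> {\<alpha> e..?l} \<union> {?h..\<beta> e}"
    using cut Inn_in_L[OF e] conn_slice_interior[OF X_conn e, of m] E_iff[OF e, of m] by (force simp: not_less)
  from measure_two_intervals[OF this]
  have 1: "measure lebesgue {t. 0 < t \<and> t < elen G e \<and> Inn e t \<in> L - X m} \<le> \<bar>?l - \<alpha> e\<bar> + \<bar>\<beta> e - ?h\<bar>" .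
  have "{t. 0 < t \<and> t < elen G e \<and> Inn e t \<in> X m - L} \<subseteq> {?l..\<alpha> e} \<union> {\<beta> e..?h}"
    using cut Inn_in_L[OF e] slice_lo_hi[of _ "X m" e] E_iff[OF e, of m] by force
  from measure_two_intervals[OF this]
  have 2: "measure lebesgue {t. 0 < t \<and> t < elen G e \<and> Inn e t \<in> X m - L} \<le> \<bar>\<alpha> e - ?l\<bar> + \<bar>?h - \<beta> e\<bar>" .
  show "measure lebesgue {t. 0 < t \<and> t < elen G e \<and> Inn e t \<in> L - X m} +
      measure lebesgue {t. 0 < t \<and> t < elen G e \<and> Inn e t \<in> X m - L} \<le> 2 * (\<bar>?l - \<alpha> e\<bar> + \<bar>?h - \<beta> e\<bar>)"
    using 1 2 by (simp add: abs_minus_commute)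
qed

lemma valuation_lim:
  assumes "valuation G v" "\<And>m. piece G (X m)" shows "(\<lambda>m. v (X m)) \<longlonglongrightarrow> v L"
proof (rule tendstoI)
  fix \<epsilon> :: real assume "0 < \<epsilon>"
  then obtain \<delta> where \<delta>: "0 < \<delta>"
      "\<And>Y. piece G Y \<Longrightarrow> plen G (L - Y) + plen G (Y - L) < \<delta> \<Longrightarrow> \<bar>v Y - v L\<bar> < \<epsilon>"
    using assms(1) piece_L unfolding valuation_def by meson
  have "(\<lambda>m. \<Sum>e\<in>edges G. 2 * (\<bar>lo (X m) e - \<alpha> e\<bar> + \<bar>hi (X m) e - \<beta> e\<bar>)) \<longlonglongrightarrow>
      (\<Sum>e\<in>edges G. 2 * (\<bar>\<alpha> e - \<alpha> e\<bar> + \<bar>\<beta> e - \<beta> e\<bar>))"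
    using lo_lim hi_lim by (intro tendsto_intros) auto
  then have "eventually (\<lambda>m. (\<Sum>e\<in>edges G. 2 * (\<bar>lo (X m) e - \<alpha> e\<bar> + \<bar>hi (X m) e - \<beta> e\<bar>)) < \<delta>) sequentially"
    using \<delta>(1) by (intro order_tendstoD(2)) auto
  then show "eventually (\<lambda>m. dist (v (X m)) (v L) < \<epsilon>) sequentially"
  proof eventually_elim
    case (elim m)
    then show ?case using \<delta>(2)[OF assms(2)] le_less_trans[OF plen_diff_le] by (simp add: dist_real_def)
  qed
qed

end

section \<open>Extraction of a convergent subsequence of partitions\<close>

lemma common_subsequence:
  fixes F :: "(nat \<Rightarrow> real) set"
  assumes "finite F" "\<And>f. f \<in> F \<Longrightarrow> bounded (range f)"
  shows "\<exists>r. strict_mono (r :: nat \<Rightarrow> nat) \<and> (\<forall>f\<in>F. convergent (f \<circ> r))"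
  using assms
proof (induction rule: finite_induct)
  case empty
  then show ?case by (auto intro: strict_mono_id)
next
  case (insert f F)
  have "\<exists>r. strict_mono (r :: nat \<Rightarrow> nat) \<and> (\<forall>f\<in>F. convergent (f \<circ> r))"
    by (intro insert.IH insert.prems) simp
  then obtain r where r: "strict_mono (r :: nat \<Rightarrow> nat)" "\<forall>f\<in>F. convergent (f \<circ> r)" by blast
  have "bounded (range (f \<circ> r))"
    by (rule bounded_subset[OF insert.prems[of f]]) auto
  then obtain l q where q: "strict_mono (q :: nat \<Rightarrow> nat)" "((f \<circ> r) \<circ> q) \<longlonglongrightarrow> l"
    using bounded_imp_convergent_subsequence by blast
  have "convergent (g \<circ> (r \<circ> q))" if "g \<in> insert f F" for g
  proof (cases "g = f")
    case True
    then show ?thesis using q(2) by (auto simp: convergent_def comp_assoc)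
  next
    case False
    then show ?thesis using r(2) that convergent_subseq_convergent[OF _ q(1), of "g \<circ> r"]
      by (auto simp: comp_assoc)
  qed
  then show ?case using strict_mono_o[OF r(1) q(1)] by blast
qed

text \<open>Coding truth values as 0 and 1 lets the same extraction fix the combinatorial type. The
  values have distance 1, so being within 1/2 of the limit determines them.\<close>

lemma convergent_of_bool:
  assumes "convergent (\<lambda>m. of_bool (B m) :: real)"
  shows "eventually (\<lambda>N. \<forall>m\<ge>N. B m = B N) sequentially"
proof -
  obtain l where "(\<lambda>m. of_bool (B m) :: real) \<longlonglongrightarrow> l" using assms by (auto simp: convergent_def)
  then have "eventually (\<lambda>m. dist (of_bool (B m) :: real) l < 1/2) sequentially" by (rule tendstoD) simp
  then obtain N where N: "\<And>m. m \<ge> N \<Longrightarrow> dist (of_bool (B m) :: real) l < 1/2"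
    by (auto simp: eventually_sequentially)
  have "B m = (l > 1/2)" if "m \<ge> N" for m
    using N[OF that] by (cases "B m") (auto simp: dist_real_def abs_if split: if_splits)
  then have "\<forall>n\<ge>N. \<forall>m\<ge>n. B m = B n" by simp
  then show ?thesis unfolding eventually_sequentially by blast
qed

context height_forest
begin

lemma convergent_pieces:
  fixes X :: "nat \<Rightarrow> nat \<Rightarrow> ('v, 'e) gpoint set"
  assumes X: "\<And>m i. i < k \<Longrightarrow> X m i \<subseteq> points G \<and> conn (X m i)"
  obtains r where "strict_mono (r :: nat \<Rightarrow> nat)"
    "\<And>i. i < k \<Longrightarrow> \<exists>\<alpha> \<beta> E W. piece_limit G h (\<lambda>m. X (r m) i) \<alpha> \<beta> E W"
proof -
  let ?E = "{..<k} \<times> edges G" and ?V = "{..<k} \<times> verts G"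
  define fE where "fE = (\<lambda>(i, e) m. slice (X m i) e \<noteq> {})"
  define fV where "fV = (\<lambda>(i, w) m. Vtx w \<in> X m i)"
  define F where "F = (\<lambda>(i, e) m. lo (X m i) e) ` ?E \<union> (\<lambda>(i, e) m. hi (X m i) e) ` ?E \<union>
    (\<lambda>p m. of_bool (fE p m)) ` ?E \<union> (\<lambda>p m. of_bool (fV p m)) ` ?V"
  have fin: "finite ?E" "finite ?V" using wf by (auto simp: wf_cgraph_def)
  have "finite F" using fin by (simp add: F_def)
  moreover have "bounded (range f)" if "f \<in> F" for f
  proof -
    from that consider i e where "e \<in> edges G" "f = (\<lambda>m. lo (X m i) e)"
      | i e where "e \<in> edges G" "f = (\<lambda>m. hi (X m i) e)" | B where "f = (\<lambda>m. of_bool (B m))"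
      unfolding F_def by (elim UnE imageE) force+
    then show ?thesis
    proof cases
      case 1
      have "\<bar>lo (X m i) e\<bar> \<le> elen G e" for m using lo_hi_range[OF 1(1), of "X m i"] by linarith
      then show ?thesis unfolding bounded_iff 1(2) by auto
    next
      case 2
      have "\<bar>hi (X m i) e\<bar> \<le> elen G e" for m using lo_hi_range[OF 2(1), of "X m i"] by linarith
      then show ?thesis unfolding bounded_iff 2(2) by auto
    next
      case 3
      then show ?thesis unfolding bounded_iff by (intro exI[of _ 1]) auto
    qed
  qed
  ultimately obtain q where q: "strict_mono (q :: nat \<Rightarrow> nat)" "\<And>f. f \<in> F \<Longrightarrow> convergent (f \<circ> q)"
    using common_subsequence[of F] by blast
  have "eventually (\<lambda>N. \<forall>p\<in>?E. \<forall>m\<ge>N. fE p (q m) = fE p (q N)) sequentially"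
  proof (intro eventually_ball_finite[OF fin(1)] ballI convergent_of_bool)
    fix p assume "p \<in> ?E"
    then have "(\<lambda>m. of_bool (fE p m)) \<in> F" unfolding F_def by blast
    from q(2)[OF this] show "convergent (\<lambda>m. of_bool (fE p (q m)) :: real)" by (simp add: o_def)
  qed
  moreover have "eventually (\<lambda>N. \<forall>p\<in>?V. \<forall>m\<ge>N. fV p (q m) = fV p (q N)) sequentially"
  proof (intro eventually_ball_finite[OF fin(2)] ballI convergent_of_bool)
    fix p assume "p \<in> ?V"
    then have "(\<lambda>m. of_bool (fV p m)) \<in> F" unfolding F_def by blast
    from q(2)[OF this] show "convergent (\<lambda>m. of_bool (fV p (q m)) :: real)" by (simp add: o_def)
  qed
  ultimately have "eventually (\<lambda>N. (\<forall>p\<in>?E. \<forall>m\<ge>N. fE p (q m) = fE p (q N)) \<and>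
      (\<forall>p\<in>?V. \<forall>m\<ge>N. fV p (q m) = fV p (q N))) sequentially"
    by (rule eventually_conj)
  then have "\<exists>N. (\<forall>p\<in>?E. \<forall>m\<ge>N. fE p (q m) = fE p (q N)) \<and>
      (\<forall>p\<in>?V. \<forall>m\<ge>N. fV p (q m) = fV p (q N))"
    by (rule eventually_happens'[OF sequentially_bot])
  then obtain N where N: "\<And>p m. p \<in> ?E \<Longrightarrow> m \<ge> N \<Longrightarrow> fE p (q m) = fE p (q N)"
      "\<And>p m. p \<in> ?V \<Longrightarrow> m \<ge> N \<Longrightarrow> fV p (q m) = fV p (q N)"
    by blast
  \<comment> \<open>The shift by \<open>N\<close> drops the terms in which the type may still
    change.\<close>
  define r where "r = (\<lambda>m. q (m + N))"
  have "strict_mono r" using q(1) by (auto simp: r_def strict_mono_def)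
  moreover have "piece_limit G h (\<lambda>m. X (r m) i) (\<lambda>e. lim (\<lambda>m. lo (X (q m) i) e))
      (\<lambda>e. lim (\<lambda>m. hi (X (q m) i) e)) {e \<in> edges G. fE (i, e) (q N)} {w \<in> verts G. fV (i, w) (q N)}"
    if i: "i < k" for i
  \<comment> \<open>Cases 5 and 6 are the limits of \<open>lo\<close> and \<open>hi\<close>; 7 and 8
    are the constancy of the type.\<close>
  proof (unfold_locales, goal_cases)
    case (5 e)
    then have "(\<lambda>m. lo (X m i) e) \<in> F" using i unfolding F_def by auto
    from q(2)[OF this] show ?case unfolding r_def
      by (intro LIMSEQ_ignore_initial_segment[of "\<lambda>m. lo (X (q m) i) e"])
        (simp add: o_def convergent_LIMSEQ_iff)
  next
    case (6 e)
    then have "(\<lambda>m. hi (X m i) e) \<in> F" using i unfolding F_def by auto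
    from q(2)[OF this] show ?case unfolding r_def
      by (intro LIMSEQ_ignore_initial_segment[of "\<lambda>m. hi (X (q m) i) e"])
        (simp add: o_def convergent_LIMSEQ_iff)
  next
    case (7 e m)
    then show ?case using N(1)[of "(i, e)" "m + N"] i by (simp add: r_def fE_def)
  next
    case (8 w m)
    then show ?case using N(2)[of "(i, w)" "m + N"] i by (simp add: r_def fV_def)
  qed (use X i in auto)
  ultimately show ?thesis using that by blast
qed

text \<open>A walk between points of the two limits extends at both ends, at a cost below
  \<open>\<epsilon>\<close>, to a walk between \<open>X m\<close> and \<open>X' m\<close> for large
  \<open>m\<close>.\<close>

lemma far_limit:
  assumes "piece_limit G h X \<alpha> \<beta> E W" "piece_limit G h X' \<alpha>' \<beta>' E' W'" "\<And>m. far G s (X m) (X' m)"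
  shows "far G s (piece_limit.L G \<alpha> \<beta> E W) (piece_limit.L G \<alpha>' \<beta>' E' W')"
  unfolding far_def
proof (intro ballI allI impI)
  interpret A: piece_limit G h X \<alpha> \<beta> E W by fact
  interpret B: piece_limit G h X' \<alpha>' \<beta>' E' W' by fact
  fix x y l assume x: "x \<in> A.L" and y: "y \<in> B.L" and l: "walk G UNIV x y l"
  show "s \<le> l"
  proof (rule field_le_epsilon)
    fix \<epsilon> :: real assume "0 < \<epsilon>"
    then have "0 < \<epsilon> / 2" by simp
    \<comment> \<open>The claim does not depend on \<open>m\<close>; the filter only provides an
      \<open>m\<close> that is large enough for both approximations.\<close>
    have "eventually (\<lambda>m. s \<le> l + \<epsilon>) sequentially"
      using A.L_approx[OF x \<open>0 < \<epsilon> / 2\<close>] B.L_approx[OF y \<open>0 < \<epsilon> / 2\<close>]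
    proof eventually_elim
      case (elim m)
      then obtain x' y' i j where 1: "x' \<in> X m" "walk G UNIV x' x i" "i < \<epsilon> / 2"
        and 2: "y' \<in> X' m" "walk G UNIV y' y j" "j < \<epsilon> / 2" by blast
      have "walk G UNIV x' y' (i + (l + j))"
        using walk_trans[OF walk_trans[OF walk_sym[OF wf 2(2)] l] 1(2)] .
      then have "s \<le> i + (l + j)" using assms(3)[of m] 1(1) 2(1) by (auto simp: far_def)
      then show ?case using 1(3) 2(3) by simp
    qed
    then show "s \<le> l + \<epsilon>" by simp
  qed
qed

section \<open>Attaining the maximin share\<close>

lemma separated_conn:
  assumes "0 < s"
  shows "separated G k s P \<longleftrightarrow> (\<forall>i<k. piece G (P i) \<and> conn (P i)) \<and>
    (\<forall>i<k. \<forall>j<k. i \<noteq> j \<longrightarrow> far G s (P i) (P j))"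
  by (simp add: separated_far[OF wf assms] connected_piece_walk[OF wf] conn_def)

text \<open>By monotonicity \<open>v (points G)\<close> then bounds the value of every piece, so the
  supremum in \<open>MMS\<close> is taken over a bounded set.\<close>

lemma piece_whole: "piece G (points G)"
proof -
  have "points G = (\<Union>(e, I)\<in>(\<lambda>e. (e, {0..elen G e})) ` edges G. pt G e ` I) \<union> Vtx ` verts G"
    (is "_ = ?R")
  proof
    show "points G \<subseteq> ?R"
    proof
      fix p assume "p \<in> points G"
      then consider w where "w \<in> verts G" "p = Vtx w"
        | e t where "e \<in> edges G" "0 < t" "t < elen G e" "p = Inn e t" by (auto simp: points_def)
      then show "p \<in> ?R"
      proof cases
        case 2
        then have "p = pt G e t" "t \<in> {0..elen G e}" by (auto simp: pt_def)
        then show ?thesis using 2(1) by blast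
      qed simp
    qed
    show "?R \<subseteq> points G" using pt_in_points[OF wf] by (fastforce simp: points_def)
  qed
  moreover have "finite ((\<lambda>e. (e, {0..elen G e})) ` edges G)" using wf by (auto simp: wf_cgraph_def)
  ultimately show ?thesis unfolding piece_def
    by (intro exI[of _ "(\<lambda>e. (e, {0..elen G e})) ` edges G"] exI[of _ "verts G"]) (auto simp: is_interval_cc)
qed

lemma MMS_attained:
  assumes "valuation G v" "0 < s" "1 \<le> k"
  obtains Q where "separated G k s Q" "\<And>j. j < k \<Longrightarrow> MMS G v k s \<le> v (Q j) \<and> topped (Q j)"
proof -
  define M where "M = {Min ((\<lambda>j. v (P j)) ` {..<k}) | P. separated G k s P}"
  \<comment> \<open>The partition into empty pieces ensures that the supremum is not over the empty
    set.\<close>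
  have "separated G k s (\<lambda>_. {})"
    unfolding separated_conn[OF assms(2)] by (auto simp: far_def conn_def piece_def intro: exI[of _ "{}"])
  then have "M \<noteq> {}" by (auto simp: M_def)
  moreover have "bdd_above M"
  proof (rule bdd_aboveI)
    fix x assume "x \<in> M"
    then obtain P where P: "x = Min ((\<lambda>j. v (P j)) ` {..<k})" "separated G k s P" by (auto simp: M_def)
    have "x \<le> v (P 0)" unfolding P(1) using assms(3) by (intro Min_le) auto
    also have "piece G (P 0)" using P(2) assms(3) by (simp add: separated_conn[OF assms(2)])
    then have "v (P 0) \<le> v (points G)"
      using assms(1) piece_whole piece_points[OF wf] by (auto simp: valuation_def)
    finally show "x \<le> v (points G)" .
  qed
  ultimately have "Sup M \<in> closure M" by (rule closure_contains_Sup)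
  then obtain f where f: "\<And>m. f m \<in> M" "f \<longlonglongrightarrow> Sup M" by (auto simp: closure_sequential)
  have "\<forall>m. \<exists>P. f m = Min ((\<lambda>j. v (P j)) ` {..<k}) \<and> separated G k s P" using f(1) by (auto simp: M_def)
  then obtain P where P: "\<And>m. f m = Min ((\<lambda>j. v (P m j)) ` {..<k})" "\<And>m. separated G k s (P m)"
    by metis
  note sep = P(2)[unfolded separated_conn[OF assms(2)]]
  have P_conn: "P m i \<subseteq> points G \<and> conn (P m i)" if "i < k" for m i
    using sep[of m] that piece_points[OF wf] by simp
  obtain r where r: "strict_mono (r :: nat \<Rightarrow> nat)"
      "\<And>i. i < k \<Longrightarrow> \<exists>\<alpha> \<beta> E W. piece_limit G h (\<lambda>m. P (r m) i) \<alpha> \<beta> E W"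
    using convergent_pieces[of k P, OF P_conn] by blast
  then obtain \<alpha> \<beta> E W
    where lim: "\<And>i. i < k \<Longrightarrow> piece_limit G h (\<lambda>m. P (r m) i) (\<alpha> i) (\<beta> i) (E i) (W i)"
    by metis
  define Q where "Q = (\<lambda>i. piece_limit.L G (\<alpha> i) (\<beta> i) (E i) (W i))"
  have "piece G (Q i) \<and> conn (Q i) \<and> topped (Q i) \<and> Sup M \<le> v (Q i)" if i: "i < k" for i
  proof -
    interpret piece_limit G h "\<lambda>m. P (r m) i" "\<alpha> i" "\<beta> i" "E i" "W i" using lim[OF i] .
    have "(\<lambda>m. v (P (r m) i)) \<longlonglongrightarrow> v (Q i)"
      unfolding Q_def using sep i by (intro valuation_lim[OF assms(1)]) auto
    moreover have "(\<lambda>m. f (r m)) \<longlonglongrightarrow> Sup M"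
      using LIMSEQ_subseq_LIMSEQ[OF f(2) r(1)] by (simp add: o_def)
    \<comment> \<open>Each piece is worth at least the minimum of its partition, and these minima
      tend to \<open>Sup M\<close>.\<close>
    moreover have "f (r m) \<le> v (P (r m) i)" for m unfolding P(1) using i by (intro Min_le) auto
    ultimately have "Sup M \<le> v (Q i)" by (intro LIMSEQ_le) auto
    then show ?thesis using piece_L conn_L topped_L by (simp add: Q_def)
  qed
  moreover have "far G s (Q i) (Q j)" if "i < k" "j < k" "i \<noteq> j" for i j
    unfolding Q_def using that sep by (intro far_limit[OF lim lim]) auto
  ultimately show ?thesis
    using that[of Q] by (simp add: separated_conn[OF assms(2)] MMS_def M_def)
qed

end

theorem theorem3:
  fixes G :: "('v, 'e) cgraph" and n :: nat and s :: real
    and v :: "nat \<Rightarrow> ('v, 'e) gpoint set \<Rightarrow> real"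
  assumes "wf_cgraph G" and "forest G" and "s > 0" and "n \<ge> 1"
    and "\<forall>i<n. valuation G (v i)"
  shows "\<exists>A. separated G n s A \<and> (\<forall>i<n. v i (A i) \<ge> MMS G (v i) n s)"
proof -
  obtain h where "height_function G h" using forest_height_function assms(1,2) by blast
  then interpret height_forest G h using assms(1) by unfold_locales
  have "\<forall>i<n. \<exists>Q. separated G n s Q \<and> (\<forall>j<n. MMS G (v i) n s \<le> v i (Q j) \<and> topped (Q j))"
    using MMS_attained assms(3-5) by metis
  then obtain P where P: "\<And>i. i < n \<Longrightarrow> separated G n s (P i)"
      "\<And>i j. i < n \<Longrightarrow> j < n \<Longrightarrow> MMS G (v i) n s \<le> v i (P i j) \<and> topped (P i j)"
    by metis
  note sep = P(1)[unfolded separated_conn[OF assms(3)]]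
  \<comment> \<open>Each agent brings all \<open>n\<close> pieces of its own partition, so the
    counting hypothesis of the allocation starts as an equality.\<close>
  have "\<exists>f. (\<forall>i\<in>{..<n}. f i \<in> {..<n}) \<and>
      (\<forall>i\<in>{..<n}. \<forall>k\<in>{..<n}. i \<noteq> k \<longrightarrow> far G s (P i (f i)) (P k (f k)))"
    using sep P(2) assms(3) by (intro greedy_allocation) auto
  then obtain f where f: "\<And>i. i < n \<Longrightarrow> f i < n"
      "\<And>i k. i < n \<Longrightarrow> k < n \<Longrightarrow> i \<noteq> k \<Longrightarrow> far G s (P i (f i)) (P k (f k))" by auto
  have "separated G n s (\<lambda>i. P i (f i))"
    unfolding separated_conn[OF assms(3)] using sep f by auto
  then show ?thesis using P(2) f(1) by blast
qed

end
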